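(* Let $A$ be a test-ring, i.e. a local, commutative, unital $k$-algebra with nilpotent maximal ideal $\mathfrak{n}$, and let $f\colon U\subseteq\mathcal{C}_A^m\to\mathcal{C}_A^p$ be a textile map on an $\mathfrak{m}$-adic neighbourhood $U$ of $0$ with $f(0)=0$. Write $f$ in the form $f=\ell+h$ with $\ell=T_0f$ the tangent map of $f$ at $0$. Assume that $\ell$ admits a scission $\sigma$ for which $\sigma h$ is contractive on $U$, and that $f$ has constant rank at $0$ with respect to $\ker(\ell\sigma)$. Then there exist locally invertible textile maps $u\colon U\to\mathcal{C}_A^m$ and $v\colon f(U)\to\mathcal{C}_A^p$ at $0$ such that $$v\,f\,u^{-1}=\ell .$$
   Context: Let $k$ be a field of characteristic $0$ and $n\ge1$. $\mathcal{C}_A$ is the space of $n$-cords with coefficients in $A$, i.e. of families $(c_\alpha)_{\alpha\in\mathbb{N}^n}$ in $A$ ($\mathbb N\ni 0$), identified with $A[[x_1,\dots,x_n]]$. The $\mathfrak{m}$-adic topology on $\mathcal{C}_A^m$ has as basic neighbourhoods of $0$ the sets of vectors of power series of order $\ge l$ in $x$, $l\in\mathbb N$. Textile maps: a map $\mathcal{C}_A^m\to\mathcal{C}_A^p$ is textile if every coefficient of the image of $c$ is a polynomial over $A$ in the coefficients of $c$ (each polynomial involving only finitely many of them); a map on a subset of $\mathcal{C}_A^m$ is textile if it is the restriction of a textile map on $\mathcal{C}_A^m$. Refined order and contractivity: fix $N$ with $\mathfrak{n}^N=0$. For $0\ne a\in A$ put $\mathrm{pow}(a)=\max\{i:a\in\mathfrak{n}^i\}$,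 where $\mathfrak{n}^0=A$, and $\mathrm{pow}(0)=N$; for a finite family of elements take the minimum. For $c\in\mathcal{C}_A^m$ the refined order is $\mathrm{ORD}(c)=(\mathrm{ord}\,c,\ \mathrm{pow}(c_{\mathrm{ord}\,c}))$, where $\mathrm{ord}\,c$ is the order of $c$ in $x$ and $c_{\mathrm{ord}\,c}$ denotes the coefficients of $c$ in degree $\mathrm{ord}\,c$; these pairs are ordered lexicographically, and $\mathrm{ORD}(0)$ is larger than all other values. A map $g\colon U\to\mathcal{C}_A^q$ is contractive on $U$ if $\mathrm{ORD}(g(a)-g(b))>\mathrm{ORD}(a-b)$ for all $a\neq b$ in $U$. Tangent map: $T_af\cdot w=\frac1s\big(f(a+sw)-f(a)\big)\big|_{s=0}$ (formal directional derivative), for $w\in\mathcal{C}_A^m$. Scission: a scission of a textile linear map $\ell\colon\mathcal{C}_A^m\to\mathcal{C}_A^p$ is a textile linear map $\sigma\colon\mathcal{C}_A^p\to\mathcal{C}_A^m$ with $\ell\sigma\ell=\ell$; then $\ker(\ell\sigma)$ is a direct complement of $\mathrm{im}(\ell)$ in $\mathcal{C}_A^p$. Curves: a curve in a subset $M\subseteq\mathcal{C}_A^r$ is a textile map $V\to\mathcal{C}_A^r$ with image in $M$, where $V$ is an $\mathfrak{m}$-adic neighbourhood of $0$ in $\mathcal{C}_A$. Constant rank: let $J$ be a direct complement of $\mathrm{im}(T_0f)$ in $\mathcal{C}_A^p$. Then $f$ has constant rank at $0$ with respect to $J$ if for all curves $\gamma$ in $U$ with $\gamma(0)=0$ and all curves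 $\eta$ in $\mathcal{C}_A^p$ there exist unique curves $\rho$ in $\mathcal{C}_A^m$ and $\tau$ in $J$ such that $\eta=T_\gamma f\cdot\rho+\tau$, where $T_\gamma f\cdot\rho$ is the curve $s\mapsto T_{\gamma(s)}f\cdot\rho(s)$. Locally invertible at $0$ means having a textile inverse near $0$ with respect to the $\mathfrak{m}$-adic topology. *)

theory Defs
  imports
    "HOL-Computational_Algebra.Polynomial"
    "HOL-Library.Function_Algebras"
    "HOL-Library.Poly_Mapping"
    "HOL-Library.Product_Lexorder"
    "HOL-Library.Extended_Nat"
begin

section \<open>Test-rings\<close>

definition k_algebra :: "('k::field \<Rightarrow> 'a::comm_ring_1 \<Rightarrow> 'a) \<Rightarrow> bool" where
  "k_algebra scl \<longleftrightarrow> vector_space scl \<and> (\<forall>c x y. scl c (x * y) = scl c x * y)"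

text \<open>The ideals of \<open>'a\<close> are its submodules as a module over itself.\<close>

abbreviation is_ideal :: "'a::comm_ring_1 set \<Rightarrow> bool" where
  "is_ideal I \<equiv> module.subspace (*) I"

definition is_maximal_ideal :: "'a::comm_ring_1 set \<Rightarrow> bool" where
  "is_maximal_ideal M \<longleftrightarrow> is_ideal M \<and> M \<noteq> UNIV \<and>
     (\<forall>I. is_ideal I \<and> M \<subseteq> I \<longrightarrow> I = M \<or> I = UNIV)"

definition local_ring_with :: "'a::comm_ring_1 set \<Rightarrow> bool" where
  "local_ring_with \<nn> \<longleftrightarrow> is_maximal_ideal \<nn> \<and> (\<forall>M. is_maximal_ideal M \<longrightarrow> M = \<nn>)"

fun ideal_pow :: "'a::comm_ring_1 set \<Rightarrow> nat \<Rightarrow> 'a set" where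
  "ideal_pow I 0 = UNIV"
| "ideal_pow I (Suc i) = module.span (*) {x * y | x y. x \<in> ideal_pow I i \<and> y \<in> I}"

definition test_ring :: "('k::field \<Rightarrow> 'a::comm_ring_1 \<Rightarrow> 'a) \<Rightarrow> 'a set \<Rightarrow> bool" where
  "test_ring scl \<nn> \<longleftrightarrow> k_algebra scl \<and> local_ring_with \<nn> \<and> (\<exists>N. ideal_pow \<nn> N = {0})"


section \<open>Vectors of cords and the \<open>\<mm>\<close>-adic topology\<close>

text \<open>
  An element of \<open>('m, 'n, 'a) cords\<close> is a vector, indexed by the finite type \<open>'m\<close>, of
  cords \<open>(c\<^sub>\<alpha>)\<close> with \<open>\<alpha>\<close> ranging over \<open>'n \<Rightarrow> nat\<close>, i.e. of power series
  in variables indexed by the finite type \<open>'n\<close>. The space of single cords is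
  \<open>(unit, 'n, 'a) cords\<close>. Zero, sums and differences are the pointwise ones.
\<close>

type_synonym ('m, 'n, 'a) cords = "'m \<Rightarrow> ('n \<Rightarrow> nat) \<Rightarrow> 'a"

definition smult_cords :: "'a::comm_ring_1 \<Rightarrow> ('m, 'n, 'a) cords \<Rightarrow> ('m, 'n, 'a) cords" where
  "smult_cords s c = (\<lambda>j \<alpha>. s * c j \<alpha>)"

definition deg :: "('n::finite \<Rightarrow> nat) \<Rightarrow> nat" where
  "deg \<alpha> = (\<Sum>i\<in>UNIV. \<alpha> i)"

text \<open>The order of the zero vector is \<open>\<infinity>\<close>, the infimum of the empty set.\<close>

definition ord :: "('m, 'n::finite, 'a::zero) cords \<Rightarrow> enat" where
  "ord c = Inf {enat (deg \<alpha>) | j \<alpha>. c j \<alpha> \<noteq> 0}"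

definition nhd0 :: "('m, 'n::finite, 'a::zero) cords set \<Rightarrow> bool" where
  "nhd0 V \<longleftrightarrow> (\<exists>l. {c. enat l \<le> ord c} \<subseteq> V)"


section \<open>Textile maps\<close>

text \<open>Polynomials over \<open>'a\<close> in arbitrarily many variables \<open>'v\<close> are finitely supported
  functions on the monomials, and monomials are finitely supported exponent functions.\<close>

definition eval_mpoly :: "('v \<Rightarrow> 'a) \<Rightarrow> (('v \<Rightarrow>\<^sub>0 nat) \<Rightarrow>\<^sub>0 'a::comm_ring_1) \<Rightarrow> 'a" where
  "eval_mpoly x P =
     (\<Sum>t\<in>Poly_Mapping.keys P. Poly_Mapping.lookup P t *
        (\<Prod>v\<in>Poly_Mapping.keys t. x v ^ Poly_Mapping.lookup t v))"

definition textile :: "(('m, 'n, 'a::comm_ring_1) cords \<Rightarrow> ('p, 'n, 'a) cords) \<Rightarrow> bool" where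
  "textile f \<longleftrightarrow> (\<forall>j \<alpha>. \<exists>P :: (('m \<times> ('n \<Rightarrow> nat)) \<Rightarrow>\<^sub>0 nat) \<Rightarrow>\<^sub>0 'a.
     \<forall>c. f c j \<alpha> = eval_mpoly (\<lambda>(i, \<beta>). c i \<beta>) P)"

definition textile_on ::
    "('m, 'n, 'a::comm_ring_1) cords set \<Rightarrow> (('m, 'n, 'a) cords \<Rightarrow> ('p, 'n, 'a) cords) \<Rightarrow> bool" where
  "textile_on S f \<longleftrightarrow> (\<exists>F. textile F \<and> (\<forall>c\<in>S. f c = F c))"

text \<open>
  The tangent map is the value at \<open>s = 0\<close> of the polynomial \<open>(f (a + s w) - f a) / s\<close>, taken
  in each coefficient. When \<open>'a\<close> contains the rationals a polynomial over \<open>'a\<close> is determined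
  by its values, so for textile \<open>f\<close> the polynomial \<open>r\<close> below exists and is unique.
  The direction \<open>w\<close> is arbitrary, even for a map on a neighbourhood \<open>U\<close> of \<open>0\<close>: such
  a map is given by the textile map \<open>f\<close> on the whole space that it restricts, and the tangent
  map is formed from \<open>f\<close>.
\<close>

definition tangent ::
    "(('m, 'n, 'a::comm_ring_1) cords \<Rightarrow> ('p, 'n, 'a) cords) \<Rightarrow> ('m, 'n, 'a) cords
      \<Rightarrow> ('m, 'n, 'a) cords \<Rightarrow> ('p, 'n, 'a) cords" where
  "tangent f a w = (\<lambda>j \<alpha>. THE d. \<exists>r.
     (\<forall>s. f (a + smult_cords s w) j \<alpha> - f a j \<alpha> = s * poly r s) \<and> d = poly r 0)"

definition textile_linear :: "(('m, 'n, 'a::comm_ring_1) cords \<Rightarrow> ('p, 'n, 'a) cords) \<Rightarrow> bool" where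
  "textile_linear g \<longleftrightarrow> textile g \<and> module_hom smult_cords smult_cords g"

definition scission ::
    "(('m, 'n, 'a::comm_ring_1) cords \<Rightarrow> ('p, 'n, 'a) cords)
      \<Rightarrow> (('p, 'n, 'a) cords \<Rightarrow> ('m, 'n, 'a) cords) \<Rightarrow> bool" where
  "scission l \<sigma> \<longleftrightarrow> textile_linear l \<and> textile_linear \<sigma> \<and> l \<circ> \<sigma> \<circ> l = l"


section \<open>Refined order and contractive maps\<close>

definition pow :: "'a::comm_ring_1 set \<Rightarrow> nat \<Rightarrow> 'a \<Rightarrow> nat" where
  "pow \<nn> N a = (if a = 0 then N else Max {i. a \<in> ideal_pow \<nn> i})"

text \<open>Pairs are compared lexicographically, so \<open>ORD \<nn> N 0 = (\<infinity>, N)\<close> exceeds every other value.\<close>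

definition ORD :: "'a::comm_ring_1 set \<Rightarrow> nat \<Rightarrow> ('m::finite, 'n::finite, 'a) cords \<Rightarrow> enat \<times> nat" where
  "ORD \<nn> N c =
     (ord c, if c = 0 then N else Min {pow \<nn> N (c j \<alpha>) | j \<alpha>. enat (deg \<alpha>) = ord c})"

definition contractive ::
    "'a::comm_ring_1 set \<Rightarrow> nat \<Rightarrow> ('m::finite, 'n::finite, 'a) cords set
      \<Rightarrow> (('m, 'n, 'a) cords \<Rightarrow> ('q::finite, 'n, 'a) cords) \<Rightarrow> bool" where
  "contractive \<nn> N U g \<longleftrightarrow> (\<forall>a\<in>U. \<forall>b\<in>U. a \<noteq> b \<longrightarrow> ORD \<nn> N (g a - g b) > ORD \<nn> N (a - b))"


section \<open>Curves and constant rank\<close>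

definition curve ::
    "('r, 'n::finite, 'a::comm_ring_1) cords set
      \<Rightarrow> ((unit, 'n, 'a) cords \<Rightarrow> ('r, 'n, 'a) cords) \<Rightarrow> bool" where
  "curve M \<gamma> \<longleftrightarrow> (\<exists>V. nhd0 V \<and> textile_on V \<gamma> \<and> \<gamma> ` V \<subseteq> M)"

text \<open>
  Each curve comes with its own neighbourhood of \<open>0\<close>, so curves are identified when they agree
  near \<open>0\<close>, and the equation \<open>\<eta> = T\<^sub>\<gamma> f \<cdot> \<rho> + \<tau>\<close> is required near \<open>0\<close>.
\<close>

definition rank_decomp ::
    "(('m, 'n::finite, 'a::comm_ring_1) cords \<Rightarrow> ('p, 'n, 'a) cords) \<Rightarrow> ('p, 'n, 'a) cords set
      \<Rightarrow> ((unit, 'n, 'a) cords \<Rightarrow> ('m, 'n, 'a) cords) \<Rightarrow> ((unit, 'n, 'a) cords \<Rightarrow> ('p, 'n, 'a) cords)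
      \<Rightarrow> ((unit, 'n, 'a) cords \<Rightarrow> ('m, 'n, 'a) cords) \<Rightarrow> ((unit, 'n, 'a) cords \<Rightarrow> ('p, 'n, 'a) cords)
      \<Rightarrow> bool" where
  "rank_decomp f J \<gamma> \<eta> \<rho> \<tau> \<longleftrightarrow> curve UNIV \<rho> \<and> curve J \<tau> \<and>
     nhd0 {s. \<eta> s = tangent f (\<gamma> s) (\<rho> s) + \<tau> s}"

text \<open>
  The uniqueness is that of the decomposition of \<open>\<eta>\<close> into the part \<open>T\<^sub>\<gamma> f \<cdot> \<rho>\<close> and the
  part \<open>\<tau>\<close> in the complement \<open>J\<close>; thus \<open>\<rho>\<close> is unique modulo the kernel of \<open>T\<^sub>\<gamma> f\<close>. Uniqueness
  of \<open>\<rho>\<close> itself, for constant \<open>\<gamma> = 0\<close>, would force \<open>T\<^sub>0 f\<close> to be injective. It implies the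
  condition used here (lemma \<open>constant_rank_if_unique\<close>).
  The notion presupposes that \<open>J\<close> is a direct complement of the image of \<open>T\<^sub>0 f\<close>; this holds for
  \<open>J = ker (l \<circ> \<sigma>)\<close> when \<open>\<sigma>\<close> is a scission of \<open>l = T\<^sub>0 f\<close> (lemma \<open>scission_complement\<close>).
\<close>

definition constant_rank ::
    "(('m, 'n::finite, 'a::comm_ring_1) cords \<Rightarrow> ('p, 'n, 'a) cords) \<Rightarrow> ('m, 'n, 'a) cords set
      \<Rightarrow> ('p, 'n, 'a) cords set \<Rightarrow> bool" where
  "constant_rank f U J \<longleftrightarrow> (\<forall>\<gamma> \<eta>. curve U \<gamma> \<and> \<gamma> 0 = 0 \<and> curve UNIV \<eta> \<longrightarrow>
     (\<exists>\<rho> \<tau>. rank_decomp f J \<gamma> \<eta> \<rho> \<tau> \<and>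
       (\<forall>\<rho>' \<tau>'. rank_decomp f J \<gamma> \<eta> \<rho>' \<tau>' \<longrightarrow>
          nhd0 {s. tangent f (\<gamma> s) (\<rho>' s) = tangent f (\<gamma> s) (\<rho> s) \<and> \<tau>' s = \<tau> s})))"

lemma nhd0_mono: "nhd0 V \<Longrightarrow> V \<subseteq> W \<Longrightarrow> nhd0 W"
  unfolding nhd0_def by blast

lemma constant_rank_if_unique:
  fixes f :: "('m, 'n::finite, 'a::comm_ring_1) cords \<Rightarrow> ('p, 'n, 'a) cords"
  assumes "\<And>\<gamma> \<eta>. curve U \<gamma> \<Longrightarrow> \<gamma> 0 = 0 \<Longrightarrow> curve UNIV \<eta> \<Longrightarrow>
     \<exists>\<rho> \<tau>. rank_decomp f J \<gamma> \<eta> \<rho> \<tau> \<and>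
       (\<forall>\<rho>' \<tau>'. rank_decomp f J \<gamma> \<eta> \<rho>' \<tau>' \<longrightarrow> nhd0 {s. \<rho>' s = \<rho> s \<and> \<tau>' s = \<tau> s})"
  shows "constant_rank f U J"
  unfolding constant_rank_def
proof (intro allI impI)
  fix \<gamma> :: "(unit, 'n, 'a) cords \<Rightarrow> ('m, 'n, 'a) cords"
    and \<eta> :: "(unit, 'n, 'a) cords \<Rightarrow> ('p, 'n, 'a) cords"
  assume "curve U \<gamma> \<and> \<gamma> 0 = 0 \<and> curve UNIV \<eta>"
  then obtain \<rho> \<tau> where *: "rank_decomp f J \<gamma> \<eta> \<rho> \<tau>"
    "\<And>\<rho>' \<tau>'. rank_decomp f J \<gamma> \<eta> \<rho>' \<tau>' \<Longrightarrow> nhd0 {s. \<rho>' s = \<rho> s \<and> \<tau>' s = \<tau> s}"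
    using assms by blast
  show "\<exists>\<rho> \<tau>. rank_decomp f J \<gamma> \<eta> \<rho> \<tau> \<and>
       (\<forall>\<rho>' \<tau>'. rank_decomp f J \<gamma> \<eta> \<rho>' \<tau>' \<longrightarrow>
          nhd0 {s. tangent f (\<gamma> s) (\<rho>' s) = tangent f (\<gamma> s) (\<rho> s) \<and> \<tau>' s = \<tau> s})"
    by (intro exI conjI allI impI, rule *(1), rule nhd0_mono[OF *(2)]) auto
qed

lemma scission_complement:
  assumes "scission l \<sigma>"
  shows "\<exists>!z. fst z \<in> range l \<and> snd z \<in> {y. l (\<sigma> y) = 0} \<and> y = fst z + snd z"
proof -
  interpret l: module_hom smult_cords smult_cords l
    using assms by (auto simp: scission_def textile_linear_def)
  interpret s: module_hom smult_cords smult_cords \<sigma>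
    using assms by (auto simp: scission_def textile_linear_def)
  have lsl: "l (\<sigma> (l x)) = l x" for x
    using assms unfolding scission_def by (metis comp_apply)
  show ?thesis
  proof (rule ex1I[of _ "(l (\<sigma> y), y - l (\<sigma> y))"])
    show "fst (l (\<sigma> y), y - l (\<sigma> y)) \<in> range l \<and>
        snd (l (\<sigma> y), y - l (\<sigma> y)) \<in> {y. l (\<sigma> y) = 0} \<and>
        y = fst (l (\<sigma> y), y - l (\<sigma> y)) + snd (l (\<sigma> y), y - l (\<sigma> y))"
      by (auto simp: s.diff l.diff lsl)
  next
    fix z assume z: "fst z \<in> range l \<and> snd z \<in> {y. l (\<sigma> y) = 0} \<and> y = fst z + snd z"
    then obtain x where x: "fst z = l x" by auto
    have "l (\<sigma> y) = fst z"
      using z x by (simp add: s.add l.add lsl)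
    then show "z = (l (\<sigma> y), y - l (\<sigma> y))"
      using z by (metis add_diff_cancel_left' prod.collapse)
  qed
qed


section \<open>Local invertibility\<close>

text \<open>
  \<open>g'\<close> is a textile inverse near \<open>0\<close> of the textile map \<open>g\<close> on \<open>S\<close>. The set \<open>S\<close> need not
  be a neighbourhood of \<open>0\<close> (such as the image of a map), so the neighbourhoods are those on
  which a textile extension \<open>G\<close> of \<open>g\<close> to the whole space is inverted. If \<open>S\<close> is a
  neighbourhood of \<open>0\<close>, then shrinking \<open>W\<close> to a subset of \<open>S\<close> gives the inverse of \<open>g\<close> itself.
\<close>

definition local_inverse_on ::
    "('m, 'n::finite, 'a::comm_ring_1) cords set \<Rightarrow> (('m, 'n, 'a) cords \<Rightarrow> ('m, 'n, 'a) cords)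
      \<Rightarrow> (('m, 'n, 'a) cords \<Rightarrow> ('m, 'n, 'a) cords) \<Rightarrow> bool" where
  "local_inverse_on S g g' \<longleftrightarrow>
     (\<exists>G W W'. textile G \<and> (\<forall>c\<in>S. g c = G c) \<and> G 0 = 0 \<and>
        nhd0 W \<and> nhd0 W' \<and> bij_betw G W W' \<and>
        textile_on W' g' \<and> (\<forall>c\<in>W. g' (G c) = c))"

definition locally_invertible_on ::
    "('m, 'n::finite, 'a::comm_ring_1) cords set
      \<Rightarrow> (('m, 'n, 'a) cords \<Rightarrow> ('m, 'n, 'a) cords) \<Rightarrow> bool" where
  "locally_invertible_on S g \<longleftrightarrow> (\<exists>g'. local_inverse_on S g g')"

end

theory Submission
  imports Defs "HOL-Library.Countable" "HOL-Library.FuncSet"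
begin

text \<open>
  Contractivity makes \<open>u = id + \<sigma> h\<close> invertible near \<open>0\<close>: a coefficient of degree \<open>d\<close> of the
  iteration \<open>x \<mapsto> y - \<sigma> (h x)\<close> is stationary after \<open>(d + 1) (N + 1)\<close> steps, whence the inverse
  is textile. Since \<open>l \<sigma> f = l u\<close>, the map \<open>\<phi> = f u\<inverse>\<close> satisfies \<open>l \<sigma> \<phi> = l\<close>, so that for \<open>w\<close> in
  the kernel of \<open>l\<close> the vector \<open>T\<^sub>x \<phi> \<cdot> w\<close> lies both in the image of the tangent map of \<open>f\<close> at
  \<open>u\<inverse> x\<close> and in the complement \<open>ker (l \<sigma>)\<close>. By constant rank it vanishes. As the characteristic is \<open>0\<close>,
  \<open>\<phi>\<close> is constant in the directions of the kernel, i.e. \<open>\<phi> x = \<phi> (\<sigma> (l x))\<close>, and subtracting from \<open>y\<close>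
  the component in \<open>ker (l \<sigma>)\<close> of \<open>\<phi> (\<sigma> (l (\<sigma> y)))\<close> is the required automorphism \<open>v\<close>.
\<close>

section \<open>Polynomial functions and textile maps\<close>

text \<open>Generated inductively so that substitution, continuity and differentiation follow by
  rule induction; \<open>polyfun_iff_eval_mpoly\<close> matches it with the polynomials in
  \<open>textile\<close>.\<close>

inductive polyfun :: "(('m, 'n, 'a::comm_ring_1) cords \<Rightarrow> 'a) \<Rightarrow> bool" where
  const: "polyfun (\<lambda>c. x)"
| coord: "polyfun (\<lambda>c. c i \<beta>)"
| add: "polyfun F \<Longrightarrow> polyfun G \<Longrightarrow> polyfun (\<lambda>c. F c + G c)"
| mult: "polyfun F \<Longrightarrow> polyfun G \<Longrightarrow> polyfun (\<lambda>c. F c * G c)"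

lemma polyfun_sum: "(\<And>t. t \<in> T \<Longrightarrow> polyfun (F t)) \<Longrightarrow> polyfun (\<lambda>c. \<Sum>t\<in>T. F t c)"
  by (induction T rule: infinite_finite_induct) (auto intro: polyfun.intros)

lemma polyfun_prod: "(\<And>t. t \<in> T \<Longrightarrow> polyfun (F t)) \<Longrightarrow> polyfun (\<lambda>c. \<Prod>t\<in>T. F t c)"
  by (induction T rule: infinite_finite_induct) (auto intro: polyfun.intros)

lemma polyfun_power: "polyfun F \<Longrightarrow> polyfun (\<lambda>c. F c ^ k)"
  by (induction k) (auto intro: polyfun.intros)

lemma polyfun_uminus:
  assumes "polyfun F" shows "polyfun (\<lambda>c. - F c)"
  using polyfun.mult[OF polyfun.const[of "-1"] assms] by simp

lemma polyfun_diff: "polyfun F \<Longrightarrow> polyfun G \<Longrightarrow> polyfun (\<lambda>c. F c - G c)"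
  using polyfun.add[OF _ polyfun_uminus, of F G] by simp

section \<open>Evaluation of polynomials in arbitrarily many variables\<close>

definition eval_monom :: "('v \<Rightarrow> 'a::comm_ring_1) \<Rightarrow> ('v \<Rightarrow>\<^sub>0 nat) \<Rightarrow> 'a" where
  "eval_monom x t = (\<Prod>v\<in>Poly_Mapping.keys t. x v ^ Poly_Mapping.lookup t v)"

lemma eval_monom_superset:
  assumes "finite S" "Poly_Mapping.keys t \<subseteq> S"
  shows "eval_monom x t = (\<Prod>v\<in>S. x v ^ Poly_Mapping.lookup t v)"
  unfolding eval_monom_def by (rule prod.mono_neutral_left) (use assms in \<open>auto simp: in_keys_iff\<close>)

lemma eval_monom_add: "eval_monom x (s + t) = eval_monom x s * eval_monom x t"
proof -
  let ?S = "Poly_Mapping.keys s \<union> Poly_Mapping.keys t"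
  have "Poly_Mapping.keys (s + t) \<subseteq> ?S" by (rule Poly_Mapping.keys_add)
  then show ?thesis
    by (simp add: eval_monom_superset[of ?S] lookup_add power_add prod.distrib)
qed

lemma eval_mpoly_superset:
  assumes "finite S" "Poly_Mapping.keys P \<subseteq> S"
  shows "eval_mpoly x P = (\<Sum>t\<in>S. Poly_Mapping.lookup P t * eval_monom x t)"
  unfolding eval_mpoly_def eval_monom_def[symmetric]
  by (rule sum.mono_neutral_left) (use assms in \<open>auto simp: in_keys_iff\<close>)

lemma eval_mpoly_add: "eval_mpoly x (P + Q) = eval_mpoly x P + eval_mpoly x Q"
proof -
  let ?S = "Poly_Mapping.keys P \<union> Poly_Mapping.keys Q"
  have "Poly_Mapping.keys (P + Q) \<subseteq> ?S" by (rule Poly_Mapping.keys_add)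
  then show ?thesis
    by (simp add: eval_mpoly_superset[of ?S] lookup_add distrib_right sum.distrib)
qed

lemma eval_mpoly_single: "eval_mpoly x (Poly_Mapping.single t c) = c * eval_monom x t"
  by (subst eval_mpoly_superset[of "{t}"]) auto

lemma eval_mpoly_sum: "eval_mpoly x (\<Sum>i\<in>I. P i) = (\<Sum>i\<in>I. eval_mpoly x (P i))"
proof -
  have "eval_mpoly x 0 = 0" by (simp add: eval_mpoly_def)
  then show ?thesis
    by (induction I rule: infinite_finite_induct) (auto simp: eval_mpoly_add)
qed

text \<open>Expanding both sums gives one term per pair of monomials, and \<open>R\<close> collects
  these terms independently of \<open>x\<close>.\<close>

lemma eval_mpoly_mult_exists: "\<exists>R. \<forall>x. eval_mpoly x P * eval_mpoly x Q = eval_mpoly x R"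
proof (intro exI allI)
  fix x
  show "eval_mpoly x P * eval_mpoly x Q =
    eval_mpoly x (\<Sum>s\<in>Poly_Mapping.keys P. \<Sum>t\<in>Poly_Mapping.keys Q.
      Poly_Mapping.single (s + t) (Poly_Mapping.lookup P s * Poly_Mapping.lookup Q t))"
    by (simp add: eval_mpoly_sum eval_mpoly_single eval_monom_add)
      (simp add: eval_mpoly_superset[OF finite_keys order_refl] sum_product mult_ac)
qed

lemma polyfun_iff_eval_mpoly:
  "polyfun F \<longleftrightarrow> (\<exists>P. \<forall>c. F c = eval_mpoly (\<lambda>(i, \<beta>). c i \<beta>) P)"
proof
  assume "polyfun F"
  then show "\<exists>P. \<forall>c. F c = eval_mpoly (\<lambda>(i, \<beta>). c i \<beta>) P"
  proof induction
    case (const x)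
    show ?case
      by (rule exI[of _ "Poly_Mapping.single 0 x"]) (simp add: eval_mpoly_single eval_monom_def)
  next
    case (coord i \<beta>)
    show ?case
      by (rule exI[of _ "Poly_Mapping.single (Poly_Mapping.single (i, \<beta>) 1) 1"])
        (simp add: eval_mpoly_single eval_monom_def)
  next
    case (add F G)
    then show ?case by (metis eval_mpoly_add)
  next
    case (mult F G)
    then show ?case by (metis eval_mpoly_mult_exists)
  qed
next
  assume "\<exists>P. \<forall>c. F c = eval_mpoly (\<lambda>(i, \<beta>). c i \<beta>) P"
  then obtain P where "F = (\<lambda>c. eval_mpoly (\<lambda>(i, \<beta>). c i \<beta>) P)" by blast
  then show "polyfun F"
    by (auto simp: eval_mpoly_def split_beta
        intro!: polyfun_sum polyfun_prod polyfun_power polyfun.intros)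
qed

lemma textile_iff_polyfun: "textile f \<longleftrightarrow> (\<forall>j \<alpha>. polyfun (\<lambda>c. f c j \<alpha>))"
  unfolding textile_def polyfun_iff_eval_mpoly ..

lemma polyfun_compose:
  assumes "polyfun F" "textile g" shows "polyfun (\<lambda>c. F (g c))"
  using assms(1)
  by induction (use assms(2) in \<open>auto simp: textile_iff_polyfun intro: polyfun.intros\<close>)

lemma textile_compose:
  assumes "textile f" "textile g" shows "textile (\<lambda>c. f (g c))"
proof -
  have "polyfun (\<lambda>c. f (g c) j \<alpha>)" for j \<alpha>
    by (rule polyfun_compose[of "\<lambda>c. f c j \<alpha>"]) (use assms in \<open>simp_all add: textile_iff_polyfun\<close>)
  then show ?thesis by (simp add: textile_iff_polyfun)
qed

lemma textile_const: "textile (\<lambda>c. x)"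
  by (simp add: textile_iff_polyfun polyfun.const)

lemma textile_ident: "textile (\<lambda>c. c)"
  by (simp add: textile_iff_polyfun polyfun.coord)

lemma textile_add: "textile f \<Longrightarrow> textile g \<Longrightarrow> textile (\<lambda>c. f c + g c)"
  by (simp add: textile_iff_polyfun polyfun.add)

lemma textile_diff: "textile f \<Longrightarrow> textile g \<Longrightarrow> textile (\<lambda>c. f c - g c)"
  by (simp add: textile_iff_polyfun polyfun_diff)


section \<open>Neighbourhoods of zero and continuity\<close>

text \<open>The basic neighbourhoods of 0, phrased by coefficients instead of by \<open>ord\<close>;
  \<open>vanishing_iff_ord\<close> gives the translation.\<close>

definition vanishing :: "nat \<Rightarrow> ('m, 'n::finite, 'a::zero) cords set" where
  "vanishing L = {c. \<forall>j \<alpha>. deg \<alpha> < L \<longrightarrow> c j \<alpha> = 0}"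

lemma vanishing_iff: "c \<in> vanishing L \<longleftrightarrow> (\<forall>j \<alpha>. deg \<alpha> < L \<longrightarrow> c j \<alpha> = 0)"
  by (simp add: vanishing_def)

lemma vanishing_iff_ord: "c \<in> vanishing L \<longleftrightarrow> enat L \<le> ord c"
proof -
  have "enat L \<le> ord c \<longleftrightarrow> (\<forall>j \<alpha>. c j \<alpha> \<noteq> 0 \<longrightarrow> enat L \<le> enat (deg \<alpha>))"
    unfolding ord_def le_Inf_iff by blast
  then show ?thesis
    unfolding vanishing_iff enat_ord_simps not_less[symmetric] by blast
qed

lemma nhd0_iff: "nhd0 V \<longleftrightarrow> (\<exists>L. vanishing L \<subseteq> V)"
  unfolding nhd0_def vanishing_iff_ord[symmetric] by simp

lemma vanishing_antimono: "c \<in> vanishing l \<Longrightarrow> k \<le> l \<Longrightarrow> c \<in> vanishing k"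
  unfolding vanishing_iff_ord by (rule order_trans[of _ "enat l"]) simp_all

lemma vanishing_zero: "0 \<in> vanishing L"
  by (simp add: vanishing_iff)

lemma vanishing_add:
  "(c :: ('m, 'n::finite, 'a::comm_ring_1) cords) \<in> vanishing L \<Longrightarrow> d \<in> vanishing L \<Longrightarrow> c + d \<in> vanishing L"
  by (simp add: vanishing_iff)

lemma vanishing_diff:
  "(c :: ('m, 'n::finite, 'a::comm_ring_1) cords) \<in> vanishing L \<Longrightarrow> d \<in> vanishing L \<Longrightarrow> c - d \<in> vanishing L"
  by (simp add: vanishing_iff)

lemma vanishing_smult: "c \<in> vanishing L \<Longrightarrow> smult_cords s c \<in> vanishing L"
  by (simp add: vanishing_iff smult_cords_def)

text \<open>The topology is separated: a coefficient of degree d is already killed at level d +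
  1.\<close>

lemma eq_zero_if_vanishing:
  assumes "\<And>L. c \<in> vanishing L" shows "c = 0"
proof (intro ext)
  show "c j \<alpha> = 0 j \<alpha>" for j \<alpha>
    using assms[of "Suc (deg \<alpha>)"] by (simp add: vanishing_iff)
qed

lemma nhd0_Int:
  assumes "nhd0 V" "nhd0 W" shows "nhd0 (V \<inter> W)"
proof -
  obtain k l where "vanishing k \<subseteq> V" "vanishing l \<subseteq> W"
    using assms unfolding nhd0_iff by blast
  moreover have "vanishing (max k l) \<subseteq> vanishing k" "vanishing (max k l) \<subseteq> vanishing l"
    by (rule subsetI, erule vanishing_antimono, simp)+
  ultimately have "vanishing (max k l) \<subseteq> V \<inter> W"
    by (meson Int_greatest subset_trans)
  then show ?thesis unfolding nhd0_iff by blast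
qed

lemma nhd0_vanishing: "nhd0 (vanishing L)"
  unfolding nhd0_iff by (rule exI, rule order_refl)

lemma nhd0_UNIV: "nhd0 UNIV"
  by (simp add: nhd0_iff)

section \<open>Dependence on finitely many coefficients and continuity at 0\<close>

lemma finite_deg_less: "finite {\<alpha> :: 'n::finite \<Rightarrow> nat. deg \<alpha> < L}"
proof (rule finite_subset)
  show "{\<alpha> :: 'n \<Rightarrow> nat. deg \<alpha> < L} \<subseteq> (UNIV \<rightarrow>\<^sub>E {..<L})"
  proof
    fix \<alpha> :: "'n \<Rightarrow> nat" assume "\<alpha> \<in> {\<alpha>. deg \<alpha> < L}"
    moreover have "\<alpha> i \<le> deg \<alpha>" for i
      unfolding deg_def by (rule member_le_sum) auto
    ultimately show "\<alpha> \<in> UNIV \<rightarrow>\<^sub>E {..<L}" by (auto intro: le_less_trans)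
  qed
qed (simp add: finite_PiE)

text \<open>Only finitely many coefficients enter, so some degree bounds them all; a coordinate
  \<open>\<beta>\<close> needs level \<open>deg \<beta> + 1\<close> because \<open>vanishing\<close>
  uses a strict bound.\<close>

lemma polyfun_determined:
  assumes "polyfun F"
  shows "\<exists>L. \<forall>c d. c - d \<in> vanishing L \<longrightarrow> F c = F d"
  using assms
proof induction
  case (coord i \<beta>)
  show ?case
    by (rule exI[of _ "Suc (deg \<beta>)"]) (auto simp: vanishing_iff)
next
  case (add F G)
  then obtain k l where
    "\<And>c d. c - d \<in> vanishing k \<Longrightarrow> F c = F d" "\<And>c d. c - d \<in> vanishing l \<Longrightarrow> G c = G d" by blast
  then have "c - d \<in> vanishing (max k l) \<Longrightarrow> F c + G c = F d + G d" for c d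
    by (metis max.cobounded1 max.cobounded2 vanishing_antimono)
  then show ?case by blast
next
  case (mult F G)
  then obtain k l where
    "\<And>c d. c - d \<in> vanishing k \<Longrightarrow> F c = F d" "\<And>c d. c - d \<in> vanishing l \<Longrightarrow> G c = G d" by blast
  then have "c - d \<in> vanishing (max k l) \<Longrightarrow> F c * G c = F d * G d" for c d
    by (metis max.cobounded1 max.cobounded2 vanishing_antimono)
  then show ?case by blast
qed auto

text \<open>Continuity at 0: for finite \<open>'p\<close> only finitely many output coefficients
  have degree below \<open>l\<close>, and the largest of their levels serves for all.\<close>

lemma nhd0_textile_vimage:
  fixes f :: "('m, 'n::finite, 'a::comm_ring_1) cords \<Rightarrow> ('p::finite, 'n, 'a) cords"
  assumes f: "textile f" "f 0 = 0" and V: "nhd0 V"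
  shows "nhd0 (f -` V)"
proof -
  obtain l where l: "vanishing l \<subseteq> V" using V unfolding nhd0_iff by blast
  have "\<forall>j \<alpha>. \<exists>L. \<forall>c. c \<in> vanishing L \<longrightarrow> f c j \<alpha> = 0"
  proof (intro allI)
    fix j \<alpha>
    obtain L where "\<And>c d. c - d \<in> vanishing L \<Longrightarrow> f c j \<alpha> = f d j \<alpha>"
      using f(1) polyfun_determined unfolding textile_iff_polyfun by blast
    from this[of _ 0] show "\<exists>L. \<forall>c. c \<in> vanishing L \<longrightarrow> f c j \<alpha> = 0"
      using f(2) by auto
  qed
  then obtain L where L: "\<And>j \<alpha> c. c \<in> vanishing (L j \<alpha>) \<Longrightarrow> f c j \<alpha> = 0" by metis
  \<comment> \<open>For \<open>l = 0\<close> the set is empty and its maximum unspecified, but then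
    no coefficient has to be controlled.\<close>
  let ?S = "(\<lambda>(j, \<alpha>). L j \<alpha>) ` (UNIV \<times> {\<alpha>. deg \<alpha> < l})"
  have fin: "finite ?S" by (simp add: finite_deg_less)
  have "f c \<in> vanishing l" if c: "c \<in> vanishing (Max ?S)" for c
  proof -
    have "f c j \<alpha> = 0" if "deg \<alpha> < l" for j \<alpha>
    proof -
      have "L j \<alpha> \<le> Max ?S" by (intro Max_ge[OF fin]) (use that in force)
      then show ?thesis using c L vanishing_antimono by blast
    qed
    then show ?thesis by (simp add: vanishing_iff)
  qed
  then show ?thesis using l unfolding nhd0_iff by blast
qed


section \<open>Tangent maps\<close>

text \<open>Substituting one-variable polynomials for the coordinates, rather than only \<open>a + s w\<close>,
  yields the chain rule together with the derivative.\<close>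

definition has_derivation ::
    "(('m, 'n, 'a::comm_ring_1) cords \<Rightarrow> 'a) \<Rightarrow> (('m, 'n, 'a) cords \<Rightarrow> ('m, 'n, 'a) cords \<Rightarrow> 'a) \<Rightarrow> bool" where
  "has_derivation F D \<longleftrightarrow> (\<forall>r. \<exists>R. (\<forall>s. F (\<lambda>i \<beta>. poly (r i \<beta>) s) = poly R s) \<and>
      coeff R 1 = D (\<lambda>i \<beta>. coeff (r i \<beta>) 0) (\<lambda>i \<beta>. coeff (r i \<beta>) 1))"

lemma has_derivationE:
  assumes "has_derivation F D"
  obtains R where "\<forall>s. F (\<lambda>i \<beta>. poly (r i \<beta>) s) = poly R s"
    "coeff R 0 = F (\<lambda>i \<beta>. coeff (r i \<beta>) 0)"
    "coeff R 1 = D (\<lambda>i \<beta>. coeff (r i \<beta>) 0) (\<lambda>i \<beta>. coeff (r i \<beta>) 1)"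
proof -
  obtain R where R: "\<forall>s. F (\<lambda>i \<beta>. poly (r i \<beta>) s) = poly R s"
    "coeff R 1 = D (\<lambda>i \<beta>. coeff (r i \<beta>) 0) (\<lambda>i \<beta>. coeff (r i \<beta>) 1)"
    using assms unfolding has_derivation_def by blast
  moreover have "coeff R 0 = F (\<lambda>i \<beta>. coeff (r i \<beta>) 0)"
    using R(1)[rule_format, of 0] by (simp add: poly_0_coeff_0)
  ultimately show ?thesis using that by blast
qed

text \<open>Sum and product rules, by induction. Polynomial dependence of \<open>D\<close> on point
  and direction is expressed by substituting textile maps for both, since \<open>polyfun\<close>
  takes a single vector of cords.\<close>

lemma polyfun_has_derivation:
  fixes F :: "('m, 'n, 'a::comm_ring_1) cords \<Rightarrow> 'a"
  assumes "polyfun F"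
  shows "\<exists>D. has_derivation F D \<and> (\<forall>(a :: ('q, 'n, 'a) cords \<Rightarrow> ('m, 'n, 'a) cords) w.
    textile a \<longrightarrow> textile w \<longrightarrow> polyfun (\<lambda>c. D (a c) (w c)))"
  using assms
proof induction
  case (const x)
  show ?case
    by (rule exI[of _ "\<lambda>a w. 0"])
      (auto simp: has_derivation_def polyfun.const intro!: exI[of _ "[:x:]"])
next
  case (coord i \<beta>)
  show ?case
    by (rule exI[of _ "\<lambda>a w. w i \<beta>"]) (auto simp: has_derivation_def textile_iff_polyfun)
next
  case (add F G)
  then obtain D E where
    D: "has_derivation F D" "\<And>(a :: ('q, 'n, 'a) cords \<Rightarrow> ('m, 'n, 'a) cords) w.
      textile a \<Longrightarrow> textile w \<Longrightarrow> polyfun (\<lambda>c. D (a c) (w c))" and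
    E: "has_derivation G E" "\<And>(a :: ('q, 'n, 'a) cords \<Rightarrow> ('m, 'n, 'a) cords) w.
      textile a \<Longrightarrow> textile w \<Longrightarrow> polyfun (\<lambda>c. E (a c) (w c))"
    by blast
  have "has_derivation (\<lambda>c. F c + G c) (\<lambda>a w. D a w + E a w)"
    unfolding has_derivation_def
  proof
    fix r
    show "\<exists>R. (\<forall>s. F (\<lambda>i \<beta>. poly (r i \<beta>) s) + G (\<lambda>i \<beta>. poly (r i \<beta>) s) = poly R s) \<and>
      coeff R 1 = D (\<lambda>i \<beta>. coeff (r i \<beta>) 0) (\<lambda>i \<beta>. coeff (r i \<beta>) 1) +
        E (\<lambda>i \<beta>. coeff (r i \<beta>) 0) (\<lambda>i \<beta>. coeff (r i \<beta>) 1)"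
      by (rule has_derivationE[OF D(1), of r], rule has_derivationE[OF E(1), of r],
          rule_tac x="R + Ra" in exI, simp)
  qed
  then show ?case
    by (intro exI[of _ "\<lambda>a w. D a w + E a w"] conjI allI impI polyfun.add D(2) E(2))
next
  case (mult F G)
  then obtain D E where
    D: "has_derivation F D" "\<And>(a :: ('q, 'n, 'a) cords \<Rightarrow> ('m, 'n, 'a) cords) w.
      textile a \<Longrightarrow> textile w \<Longrightarrow> polyfun (\<lambda>c. D (a c) (w c))" and
    E: "has_derivation G E" "\<And>(a :: ('q, 'n, 'a) cords \<Rightarrow> ('m, 'n, 'a) cords) w.
      textile a \<Longrightarrow> textile w \<Longrightarrow> polyfun (\<lambda>c. E (a c) (w c))"
    by blast
  have coeff_1: "coeff (R * S) 1 = coeff R 0 * coeff S 1 + coeff R 1 * coeff S 0"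
    for R S :: "'a poly"
    by (simp add: coeff_mult)
  have "has_derivation (\<lambda>c. F c * G c) (\<lambda>a w. F a * E a w + D a w * G a)"
    unfolding has_derivation_def
  proof
    fix r
    show "\<exists>R. (\<forall>s. F (\<lambda>i \<beta>. poly (r i \<beta>) s) * G (\<lambda>i \<beta>. poly (r i \<beta>) s) = poly R s) \<and>
      coeff R 1 = F (\<lambda>i \<beta>. coeff (r i \<beta>) 0) * E (\<lambda>i \<beta>. coeff (r i \<beta>) 0) (\<lambda>i \<beta>. coeff (r i \<beta>) 1) +
        D (\<lambda>i \<beta>. coeff (r i \<beta>) 0) (\<lambda>i \<beta>. coeff (r i \<beta>) 1) * G (\<lambda>i \<beta>. coeff (r i \<beta>) 0)"
      by (rule has_derivationE[OF D(1), of r], rule has_derivationE[OF E(1), of r],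
          rule_tac x="R * Ra" in exI, simp only: poly_mult coeff_1 simp_thms)
  qed
  moreover have "polyfun (\<lambda>c. F (a c) * E (a c) (w c) + D (a c) (w c) * G (a c))"
    if "textile a" "textile w" for a w :: "('q, 'n, 'a) cords \<Rightarrow> ('m, 'n, 'a) cords"
    using that polyfun_compose[OF mult.hyps(1)] polyfun_compose[OF mult.hyps(2)]
    by (intro polyfun.add polyfun.mult D(2) E(2))
  ultimately show ?case by blast
qed

text \<open>\<open>Q\<close> is the formal derivative of \<open>R\<close>: the linear coefficient of
  R(t + s) in s. Giving it both by values and by coefficients links vanishing tangents to vanishing
  coefficients.\<close>

lemma coeff_1_pcompose_shift:
  fixes R :: "'a::comm_ring_1 poly"
  shows "\<exists>Q. (\<forall>t. poly Q t = coeff (pcompose R [:t, 1:]) 1) \<and>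
    (\<forall>n. coeff Q n = of_nat (Suc n) * coeff R (Suc n))"
proof (induction R)
  case 0
  show ?case by (rule exI[of _ 0]) simp
next
  case (pCons c R)
  then obtain Q where Q: "\<And>t. poly Q t = coeff (pcompose R [:t, 1:]) 1"
    "\<And>n. coeff Q n = of_nat (Suc n) * coeff R (Suc n)" by blast
  have 0: "coeff (pcompose R [:t, 1:]) 0 = poly R t" for t
    by (simp add: poly_pcompose flip: poly_0_coeff_0)
  \<comment> \<open>The derivative of c + X R is R + X R'.\<close>
  show ?case
    by (rule exI[of _ "R + pCons 0 Q"])
      (auto simp: pcompose_pCons Q 0 coeff_pCons algebra_simps split: nat.split)
qed

text \<open>Zero divisors may be present, so the zeros must have cancellable differences: then the
  quotient by X - a still vanishes at every other zero, and the degree drops.\<close>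

lemma poly_eq_0_if_vanishes:
  fixes q :: "'a::comm_ring_1 poly"
  assumes "infinite S" "\<And>a b x. a \<in> S \<Longrightarrow> b \<in> S \<Longrightarrow> a \<noteq> b \<Longrightarrow> (a - b) * x = 0 \<Longrightarrow> x = 0"
    and "\<And>a. a \<in> S \<Longrightarrow> poly q a = 0"
  shows "q = 0"
  using assms
proof (induction "degree q" arbitrary: q S)
  case 0
  then obtain c where q: "q = [:c:]" by (metis degree_eq_zeroE)
  obtain a where "a \<in> S" using "0.prems"(1) by fastforce
  then show ?case using "0.prems"(3)[of a] q by simp
next
  case (Suc d)
  obtain a where a: "a \<in> S" using Suc.prems(1) by fastforce
  have q: "q = [:- a, 1:] * synthetic_div q a"
    using synthetic_div_correct'[of a q] Suc.prems(3)[OF a] by simp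
  have "synthetic_div q a = 0"
  proof (rule Suc.hyps(1)[of _ "S - {a}"])
    show "d = degree (synthetic_div q a)" using Suc.hyps(2) by (metis degree_synthetic_div diff_Suc_1)
    show "poly (synthetic_div q a) b = 0" if "b \<in> S - {a}" for b
    proof (rule Suc.prems(2)[of b a])
      have "poly q b = (b - a) * poly (synthetic_div q a) b"
        by (subst q) (simp add: algebra_simps)
      then show "(b - a) * poly (synthetic_div q a) b = 0" using Suc.prems(3)[of b] that by simp
    qed (use that a in auto)
  qed (use Suc.prems in auto)
  then show ?case using q by simp
qed

section \<open>Tangent maps over a torsion-free ring\<close>

context
  assumes torsion_free: "\<forall>n (x::'a::comm_ring_1). of_nat (Suc n) * x = 0 \<longrightarrow> x = 0"
begin

text \<open>The natural numbers embed, and their differences are cancellable by torsion-freeness, so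
  they serve as the infinite set of zeros.\<close>

lemma torsion_free_poly_eq_0:
  fixes q :: "'a poly"
  assumes "\<And>t. poly q t = 0" shows "q = 0"
proof (rule poly_eq_0_if_vanishes[of "range of_nat"])
  have nz: "x = 0" if "(of_nat a - of_nat b) * x = 0" "a > b" for a b :: nat and x :: 'a
    using torsion_free[rule_format, of "a - b - 1" x] that by (simp add: of_nat_diff)
  have nz': "x = 0" if "(of_nat a - of_nat b) * x = 0" "a \<noteq> b" for a b :: nat and x :: 'a
  proof (cases "a > b")
    case False
    have "(of_nat b - of_nat a) * x = 0" using that(1) by (simp add: algebra_simps)
    then show ?thesis using nz[of b a x] False that(2) by simp
  qed (use nz that in blast)
  show "x = 0" if "a \<in> range of_nat" "b \<in> range of_nat" "a \<noteq> b" "(a - b) * x = 0" for a b x :: 'a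
    using that nz' by auto
  have "inj (of_nat :: nat \<Rightarrow> 'a)"
  proof (rule injI, rule ccontr)
    fix a b :: nat assume "of_nat a = (of_nat b :: 'a)" "a \<noteq> b"
    then show False using nz'[of a b "1::'a"] by simp
  qed
  then show "infinite (range (of_nat :: nat \<Rightarrow> 'a))" using finite_imageD by blast
qed (use assms in auto)

text \<open>This resolves the definite description in \<open>tangent\<close>: dividing the increment
  by s drops the constant coefficient of \<open>R\<close>, and the quotient is unique because a
  polynomial vanishing everywhere is 0.\<close>

lemma tangent_eqI:
  fixes f :: "('m, 'n, 'a) cords \<Rightarrow> ('p, 'n, 'a) cords"
  assumes R: "\<And>s. f (a + smult_cords s w) j \<alpha> = poly R s"
  shows "tangent f a w j \<alpha> = coeff R 1"
  unfolding tangent_def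
proof (rule the_equality)
  obtain c R' where R': "R = pCons c R'" by (cases R)
  have fa: "f a j \<alpha> = poly R 0"
    using R[of 0] by (simp add: smult_cords_def zero_fun_def[symmetric])
  show "\<exists>r. (\<forall>s. f (a + smult_cords s w) j \<alpha> - f a j \<alpha> = s * poly r s) \<and> coeff R 1 = poly r 0"
    by (rule exI[of _ R']) (simp add: R fa R' poly_0_coeff_0)
  fix d assume "\<exists>r. (\<forall>s. f (a + smult_cords s w) j \<alpha> - f a j \<alpha> = s * poly r s) \<and> d = poly r 0"
  then obtain r where r: "\<And>s. f (a + smult_cords s w) j \<alpha> - f a j \<alpha> = s * poly r s" "d = poly r 0"
    by blast
  \<comment> \<open>The difference of two quotients is kept multiplied by X, since s cannot be
    cancelled in general.\<close>
  have "pCons 0 (R' - r) = 0"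
  proof (rule torsion_free_poly_eq_0)
    fix s show "poly (pCons 0 (R' - r)) s = 0"
      using r(1)[of s] by (simp add: R fa R' algebra_simps)
  qed
  then show "d = coeff R 1" using r(2) by (simp add: R' poly_0_coeff_0)
qed

lemma has_derivation_tangent:
  fixes f :: "('m, 'n, 'a) cords \<Rightarrow> ('p, 'n, 'a) cords"
  assumes "has_derivation (\<lambda>c. f c j \<alpha>) D"
  shows "D a w = tangent f a w j \<alpha>"
proof -
  obtain R where "\<And>s. f (\<lambda>i \<beta>. poly [:a i \<beta>, w i \<beta>:] s) j \<alpha> = poly R s" "coeff R 1 = D a w"
    using has_derivationE[OF assms, of "\<lambda>i \<beta>. [:a i \<beta>, w i \<beta>:]"] by auto
  then show ?thesis
    using tangent_eqI[of f a w j \<alpha> R] by (simp add: smult_cords_def plus_fun_def)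
qed

lemma textile_has_derivation_tangent:
  fixes f :: "('m, 'n, 'a) cords \<Rightarrow> ('p, 'n, 'a) cords"
  assumes "textile f"
  shows "has_derivation (\<lambda>c. f c j \<alpha>) (\<lambda>a w. tangent f a w j \<alpha>)"
proof -
  obtain D where D: "has_derivation (\<lambda>c. f c j \<alpha>) D"
    using polyfun_has_derivation assms unfolding textile_iff_polyfun by blast
  moreover have "D = (\<lambda>a w. tangent f a w j \<alpha>)"
    using has_derivation_tangent[of f j \<alpha> D] D by blast
  ultimately show ?thesis by simp
qed

lemma textile_along_line:
  fixes f :: "('m, 'n, 'a) cords \<Rightarrow> ('p, 'n, 'a) cords"
  assumes "textile f"
  obtains R where "\<And>s. f (a + smult_cords s w) j \<alpha> = poly R s" "coeff R 1 = tangent f a w j \<alpha>"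
proof -
  obtain R where "\<And>s. f (\<lambda>i \<beta>. poly [:a i \<beta>, w i \<beta>:] s) j \<alpha> = poly R s"
    "coeff R 1 = tangent f a w j \<alpha>"
    using has_derivationE[OF textile_has_derivation_tangent[OF assms, of j \<alpha>], of "\<lambda>i \<beta>. [:a i \<beta>, w i \<beta>:]"]
    by auto
  then show ?thesis using that by (simp add: smult_cords_def plus_fun_def)
qed

lemma textile_tangent:
  fixes f :: "('m, 'n, 'a) cords \<Rightarrow> ('p, 'n, 'a) cords"
    and a w :: "('q, 'n, 'a) cords \<Rightarrow> ('m, 'n, 'a) cords"
  assumes "textile f" "textile a" "textile w"
  shows "textile (\<lambda>c. tangent f (a c) (w c))"
  unfolding textile_iff_polyfun
proof (intro allI)
  fix j \<alpha>
  have "polyfun (\<lambda>c. f c j \<alpha>)" using assms(1) unfolding textile_iff_polyfun by blast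
  then obtain D where D: "has_derivation (\<lambda>c. f c j \<alpha>) D"
    "\<And>(a :: ('q, 'n, 'a) cords \<Rightarrow> ('m, 'n, 'a) cords) w.
      textile a \<Longrightarrow> textile w \<Longrightarrow> polyfun (\<lambda>c. D (a c) (w c))"
    using polyfun_has_derivation[of "\<lambda>c. f c j \<alpha>"] by blast
  then show "polyfun (\<lambda>c. tangent f (a c) (w c) j \<alpha>)"
    using assms(2,3) has_derivation_tangent[of f j \<alpha> D] by simp
qed

text \<open>Chain rule: \<open>g\<close> turns the line into polynomial families \<open>r\<close>,
  which \<open>has_derivation\<close> admits in place of lines; only their coefficients of degree 0
  and 1 matter.\<close>

lemma tangent_compose:
  fixes f :: "('m, 'n, 'a) cords \<Rightarrow> ('p, 'n, 'a) cords" and g :: "('q, 'n, 'a) cords \<Rightarrow> ('m, 'n, 'a) cords"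
  assumes f: "textile f" and g: "textile g"
  shows "tangent (\<lambda>c. f (g c)) a w = tangent f (g a) (tangent g a w)"
proof (intro ext)
  fix j \<alpha>
  have "\<forall>i \<beta>. \<exists>r. (\<forall>s. g (a + smult_cords s w) i \<beta> = poly r s) \<and> coeff r 1 = tangent g a w i \<beta>"
    using textile_along_line[OF g] by metis
  then obtain r where r: "\<And>i \<beta> s. g (a + smult_cords s w) i \<beta> = poly (r i \<beta>) s"
    "\<And>i \<beta>. coeff (r i \<beta>) 1 = tangent g a w i \<beta>" by metis
  have r0: "coeff (r i \<beta>) 0 = g a i \<beta>" for i \<beta>
    using r(1)[of 0 i \<beta>] by (simp add: smult_cords_def zero_fun_def[symmetric] poly_0_coeff_0)
  obtain R where R: "\<forall>s. f (\<lambda>i \<beta>. poly (r i \<beta>) s) j \<alpha> = poly R s"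
    "coeff R 0 = f (\<lambda>i \<beta>. coeff (r i \<beta>) 0) j \<alpha>"
    "coeff R 1 = tangent f (\<lambda>i \<beta>. coeff (r i \<beta>) 0) (\<lambda>i \<beta>. coeff (r i \<beta>) 1) j \<alpha>"
    by (rule has_derivationE[OF textile_has_derivation_tangent[OF f, of j \<alpha>], of r])
  have "g (a + smult_cords s w) = (\<lambda>i \<beta>. poly (r i \<beta>) s)" for s
    by (intro ext) (rule r(1))
  then have "tangent (\<lambda>c. f (g c)) a w j \<alpha> = coeff R 1"
    by (intro tangent_eqI) (simp add: R)
  also have "\<dots> = tangent f (g a) (tangent g a w) j \<alpha>" unfolding R(3) r(2) r0 ..
  finally show "tangent (\<lambda>c. f (g c)) a w j \<alpha> = tangent f (g a) (tangent g a w) j \<alpha>" .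
qed

lemma tangent_linear:
  fixes g :: "('m, 'n, 'a) cords \<Rightarrow> ('p, 'n, 'a) cords"
  assumes "module_hom smult_cords smult_cords g"
  shows "tangent g a w = g w"
proof (intro ext)
  interpret module_hom smult_cords smult_cords g by (rule assms)
  fix j \<alpha>
  have "tangent g a w j \<alpha> = coeff [:g a j \<alpha>, g w j \<alpha>:] 1"
    by (rule tangent_eqI) (simp add: add scale, simp add: smult_cords_def)
  then show "tangent g a w j \<alpha> = g w j \<alpha>" by simp
qed

lemma tangent_zero_direction:
  fixes f :: "('m, 'n, 'a) cords \<Rightarrow> ('p, 'n, 'a) cords"
  shows "tangent f a 0 = 0"
proof (intro ext)
  fix j \<alpha>
  have "tangent f a 0 j \<alpha> = coeff [:f a j \<alpha>:] 1"
    by (rule tangent_eqI) (simp add: smult_cords_def zero_fun_def[symmetric])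
  then show "tangent f a 0 j \<alpha> = 0 j \<alpha>" by simp
qed

text \<open>The derivative of R(s) = f(a + s w) vanishes at every t, so it is the zero polynomial;
  torsion-freeness then kills all higher coefficients of \<open>R\<close>.\<close>

lemma constant_along_line:
  fixes f :: "('m, 'n, 'a) cords \<Rightarrow> ('p, 'n, 'a) cords"
  assumes f: "textile f" and tangent: "\<And>t. tangent f (a + smult_cords t w) w = 0"
  shows "f (a + w) = f a"
proof (intro ext)
  fix j \<alpha>
  obtain R where R: "\<And>s. f (a + smult_cords s w) j \<alpha> = poly R s"
    using textile_along_line[OF f] by metis
  obtain Q where Q: "\<And>t. poly Q t = coeff (pcompose R [:t, 1:]) 1"
    "\<And>n. coeff Q n = of_nat (Suc n) * coeff R (Suc n)"
    using coeff_1_pcompose_shift[of R] by blast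
  have "poly Q t = 0" for t
  proof -
    \<comment> \<open>Moving the base point to a + t w makes the tangent there the linear
      coefficient of R(t + s) in s.\<close>
    have shift: "a + smult_cords t w + smult_cords s w = a + smult_cords (t + s) w" for s
      by (simp add: smult_cords_def fun_eq_iff algebra_simps)
    then have "tangent f (a + smult_cords t w) w j \<alpha> = coeff (pcompose R [:t, 1:]) 1"
      by (intro tangent_eqI) (simp only: shift, simp add: R poly_pcompose)
    then show ?thesis using tangent Q(1) by simp
  qed
  then have "Q = 0" by (rule torsion_free_poly_eq_0)
  then have "coeff R (Suc n) = 0" for n
    using torsion_free[rule_format, of n] Q(2)[of n] by simp
  then have "R = [:coeff R 0:]"
    by (auto simp: poly_eq_iff coeff_pCons split: nat.split)
  then obtain c where "R = [:c:]" by blast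
  then show "f (a + w) j \<alpha> = f a j \<alpha>"
    using R[of 0] R[of 1] by (simp add: smult_cords_def zero_fun_def[symmetric])
qed

end


section \<open>Inverting perturbations of the identity by contractive maps\<close>

lemma ideal_pow_eq_0:
  fixes \<nn> :: "'a::comm_ring_1 set"
  assumes "ideal_pow \<nn> N = {0}" "N \<le> i"
  shows "ideal_pow \<nn> i = {0}"
  using assms(2)
proof (induction i rule: dec_induct)
  case (step i)
  interpret module "(*) :: 'a \<Rightarrow> 'a \<Rightarrow> 'a"
    by unfold_locales (simp_all add: algebra_simps)
  have "span {x * y | x y. x \<in> ideal_pow \<nn> i \<and> y \<in> \<nn>} \<subseteq> {0}"
    by (rule span_minimal) (use step.IH in \<open>auto simp: subspace_def\<close>)
  then show ?case using span_zero by fastforce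
qed (rule assms(1))

text \<open>A nonzero element lies in no power from the \<open>N\<close>-th on, and every element
  lies in the 0-th power, so the maximum is genuine and bounded.\<close>

lemma pow_le:
  assumes "ideal_pow \<nn> N = {0}"
  shows "pow \<nn> N a \<le> N"
proof (cases "a = 0")
  case False
  let ?S = "{i. a \<in> ideal_pow \<nn> i}"
  have S: "?S \<subseteq> {..N}"
    using False ideal_pow_eq_0[OF assms] by (metis atMost_iff mem_Collect_eq nle_le singletonD subsetI)
  moreover have "0 \<in> ?S" by simp
  ultimately have "Max ?S \<in> ?S" by (intro Max_in) (use finite_subset in blast)+
  then show ?thesis using S False by (auto simp: pow_def)
qed (simp add: pow_def)

text \<open>\<open>enat\<close> is well-ordered, so the infimum is attained; hence the minimum in
  \<open>ORD\<close> ranges over a nonempty set.\<close>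

lemma ord_attained:
  fixes c :: "('m, 'n::finite, 'a::zero) cords"
  assumes "c \<noteq> 0" obtains \<alpha> :: "'n \<Rightarrow> nat" where "enat (deg \<alpha>) = ord c"
proof -
  let ?S = "{enat (deg \<alpha>) | j \<alpha>. c j \<alpha> \<noteq> 0}"
  have "?S \<noteq> {}" using assms by (auto simp: fun_eq_iff)
  then obtain e where "e \<in> ?S" by blast
  then have "(LEAST x. x \<in> ?S) \<in> ?S" by (rule LeastI)
  then have "ord c \<in> ?S"
    unfolding ord_def Inf_enat_def if_not_P[OF \<open>?S \<noteq> {}\<close>] .
  then show ?thesis using that by auto
qed

text \<open>For nonzero \<open>c\<close> only finitely many multi-indices have degree
  \<open>ord c\<close>, so the minimum in \<open>ORD\<close> is one of the values of
  \<open>pow\<close>.\<close>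

lemma snd_ORD_le:
  fixes c :: "('m::finite, 'n::finite, 'a::comm_ring_1) cords"
  assumes "ideal_pow \<nn> N = {0}"
  shows "snd (ORD \<nn> N c) \<le> N"
proof (cases "c = 0")
  case False
  let ?S = "{pow \<nn> N (c j \<alpha>) | j \<alpha>. enat (deg \<alpha>) = ord c}"
  obtain \<alpha> :: "'n \<Rightarrow> nat" where \<alpha>: "enat (deg \<alpha>) = ord c"
    by (rule ord_attained[OF False])
  have "finite {\<beta> :: 'n \<Rightarrow> nat. deg \<beta> = deg \<alpha>}"
    by (rule finite_subset[OF _ finite_deg_less[of "Suc (deg \<alpha>)"]]) auto
  moreover have "?S = (\<lambda>(j, \<beta>). pow \<nn> N (c j \<beta>)) ` (UNIV \<times> {\<beta>. deg \<beta> = deg \<alpha>})"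
    unfolding \<alpha>[symmetric] by auto
  ultimately have "finite ?S" by simp
  moreover have "?S \<noteq> {}" using \<alpha> by blast
  ultimately have "Min ?S \<in> ?S" by (rule Min_in)
  then have "Min ?S \<le> N" using pow_le[OF assms] by force
  then show ?thesis using False by (simp add: ORD_def)
qed (simp add: ORD_def)

text \<open>Each degree carries at most \<open>N + 1\<close> values of \<open>pow\<close>, so the finite refined orders embed
  into the natural numbers.\<close>

definition ORD_ge ::
    "'a::comm_ring_1 set \<Rightarrow> nat \<Rightarrow> nat \<Rightarrow> ('m::finite, 'n::finite, 'a) cords \<Rightarrow> bool" where
  "ORD_ge \<nn> N k c \<longleftrightarrow> (\<forall>d p. ORD \<nn> N c = (enat d, p) \<longrightarrow> k \<le> d * Suc N + p)"

lemma ORD_ge_0: "ORD_ge \<nn> N 0 c"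
  by (simp add: ORD_ge_def)

lemma ORD_ge_zero: "ORD_ge \<nn> N k 0"
  by (simp add: ORD_ge_def ORD_def ord_def Inf_enat_def)

text \<open>The code d (N + 1) + p strictly increases with (d, p): a larger d adds at least N + 1
  while p drops by at most N.\<close>

lemma ORD_ge_Suc:
  assumes "ideal_pow \<nn> N = {0}" "ORD_ge \<nn> N k c" "ORD \<nn> N c < ORD \<nn> N c'"
  shows "ORD_ge \<nn> N (Suc k) c'"
  unfolding ORD_ge_def
proof (intro allI impI)
  fix d' p' assume c': "ORD \<nn> N c' = (enat d', p')"
  obtain o' p where c: "ORD \<nn> N c = (o', p)" by (cases "ORD \<nn> N c")
  have less: "o' < enat d' \<or> o' = enat d' \<and> p < p'"
    using assms(3) unfolding c c' less_prod_def by auto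
  then obtain d where d: "o' = enat d" by (cases o') auto
  have "k \<le> d * Suc N + p" using assms(2) c d unfolding ORD_ge_def by blast
  moreover have "p \<le> N" using snd_ORD_le[OF assms(1), of c] c by simp
  moreover have "d < d' \<or> d = d' \<and> p < p'" using less d by simp
  moreover have "Suc d * Suc N \<le> d' * Suc N" if "d < d'"
    using that by (intro mult_le_mono1) simp
  ultimately show "Suc k \<le> d' * Suc N + p'" by auto
qed

text \<open>As p \<le> N, the bound L (N + 1) \<le> d (N + 1) + p forces L \<le> d.\<close>

lemma vanishing_if_ORD_ge:
  assumes "ideal_pow \<nn> N = {0}" "ORD_ge \<nn> N (L * Suc N) c"
  shows "c \<in> vanishing L"
proof (cases "ord c")
  case (enat d)
  then have "L * Suc N \<le> d * Suc N + snd (ORD \<nn> N c)"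
    using assms(2) by (simp add: ORD_ge_def ORD_def)
  then have "L * Suc N < Suc d * Suc N"
    using snd_ORD_le[OF assms(1), of c] by simp
  then have "L < Suc d" unfolding mult_less_cancel2 by simp
  then show ?thesis using enat by (simp add: vanishing_iff_ord)
qed (simp add: vanishing_iff_ord)

section \<open>Contractive maps and the fixed point iteration\<close>

lemma contractive_ORD_ge:
  assumes "ideal_pow \<nn> N = {0}" "contractive \<nn> N U g" "a \<in> U" "b \<in> U" "ORD_ge \<nn> N k (a - b)"
  shows "ORD_ge \<nn> N (Suc k) (g a - g b)"
proof (cases "a = b")
  case True
  then show ?thesis by (simp add: ORD_ge_zero)
next
  case False
  then have "ORD \<nn> N (a - b) < ORD \<nn> N (g a - g b)"
    using assms(2-4) by (simp add: contractive_def)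
  then show ?thesis by (rule ORD_ge_Suc[OF assms(1,5)])
qed

text \<open>A lexicographic increase never lowers the first component, so \<open>g\<close> is
  1-Lipschitz for the order alone.\<close>

lemma contractive_vanishing:
  assumes "contractive \<nn> N U g" "a \<in> U" "b \<in> U" "a - b \<in> vanishing L"
  shows "g a - g b \<in> vanishing L"
proof (cases "a = b")
  case True
  then show ?thesis by (simp add: vanishing_zero)
next
  case False
  then have "ORD \<nn> N (a - b) < ORD \<nn> N (g a - g b)"
    using assms(1-3) by (simp add: contractive_def)
  then have "ord (a - b) \<le> ord (g a - g b)" by (auto simp: ORD_def less_prod_def)
  then show ?thesis using assms(4) unfolding vanishing_iff_ord by (rule order_trans[rotated])
qed

lemma diff_eq_diff_if_add_eq: "a + x = b + y \<Longrightarrow> x - y = b - (a :: 'a::ab_group_add)"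
  by (simp add: algebra_simps)

text \<open>Solutions of x + g x = y are the fixed points of x \<mapsto> y - g x. Contractivity is
  available on \<open>vanishing L\<close>, which the iteration preserves, so the inverse relations
  are confined to it although \<open>u'\<close> is textile everywhere.\<close>

lemma contractive_perturbation_inverse:
  fixes g :: "('m::finite, 'n::finite, 'a::comm_ring_1) cords \<Rightarrow> ('m, 'n, 'a) cords"
  assumes nil: "ideal_pow \<nn> N = {0}" and g: "textile g" "g 0 = 0"
    and contr: "contractive \<nn> N U g" and L: "vanishing L \<subseteq> U"
  obtains u' where "textile u'" "u' 0 = 0" "bij_betw (\<lambda>c. c + g c) (vanishing L) (vanishing L)"
    "\<And>c. c \<in> vanishing L \<Longrightarrow> u' c \<in> vanishing L"
    "\<And>c. c \<in> vanishing L \<Longrightarrow> u' (c + g c) = c"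
    "\<And>c. c \<in> vanishing L \<Longrightarrow> u' c + g (u' c) = c"
proof -
  have g_diff: "g a - g b \<in> vanishing k" if "a - b \<in> vanishing k" "a \<in> vanishing L" "b \<in> vanishing L" for a b k
    using contractive_vanishing[OF contr] that L by blast
  have g_in: "g a \<in> vanishing L" if "a \<in> vanishing L" for a
    using g_diff[of a 0 L] that by (simp add: g(2) vanishing_zero)
  define X where "X k y = ((\<lambda>x. y - g x) ^^ k) 0" for k y
  have X_0: "X 0 y = 0" and X_Suc: "X (Suc k) y = y - g (X k y)" for k y
    by (simp_all add: X_def)
  have textile_X: "textile (X k)" for k
  proof (induction k)
    case (Suc k)
    then show ?case
      unfolding X_Suc[abs_def] by (rule textile_diff[OF textile_ident textile_compose[OF g(1)]])
  qed (simp add: X_0[abs_def] textile_const)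
  have X_zero: "X k 0 = 0" for k
  proof (induction k)
    case (Suc k)
    show ?case unfolding X_Suc Suc g(2) by simp
  qed (rule X_0)
  have X_in: "X k y \<in> vanishing L" if "y \<in> vanishing L" for k y
  proof (induction k)
    case (Suc k)
    show ?case unfolding X_Suc by (rule vanishing_diff[OF that g_in[OF Suc]])
  qed (simp only: X_0 vanishing_zero)
  \<comment> \<open>Both signs are carried along because each step of the iteration reverses the
    difference.\<close>
  have X_step: "ORD_ge \<nn> N k (X (Suc k) y - X k y) \<and> ORD_ge \<nn> N k (X k y - X (Suc k) y)"
    if y: "y \<in> vanishing L" for k y
  proof (induction k)
    case (Suc k)
    have eq: "X (Suc (Suc k)) y - X (Suc k) y = g (X k y) - g (X (Suc k) y)"
      "X (Suc k) y - X (Suc (Suc k)) y = g (X (Suc k) y) - g (X k y)"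
      unfolding X_Suc by simp_all
    have "X k y \<in> U" for k using X_in[OF y] L by blast
    then show ?case
      unfolding eq by (intro conjI contractive_ORD_ge[OF nil contr] conjunct1[OF Suc] conjunct2[OF Suc])
  qed (simp add: ORD_ge_0)
  have X_stable: "X (M * Suc N + k) y - X (M * Suc N) y \<in> vanishing M"
    if y: "y \<in> vanishing L" for M k y
  proof (induction k)
    case (Suc k)
    let ?K = "M * Suc N + k"
    have "ORD_ge \<nn> N (M * Suc N) (X (Suc ?K) y - X ?K y)"
      using X_step[OF y, of ?K] unfolding ORD_ge_def by (meson le_add1 le_trans)
    then have "X (Suc ?K) y - X ?K y \<in> vanishing M" by (rule vanishing_if_ORD_ge[OF nil])
    note vanishing_add[OF this Suc]
    also have "(X (Suc ?K) y - X ?K y) + (X ?K y - X (M * Suc N) y) = X (Suc ?K) y - X (M * Suc N) y"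
      by (intro ext) simp
    finally show ?case by (simp only: add_Suc_right)
  qed (simp only: add_0_right diff_self vanishing_zero)
  \<comment> \<open>Degree d is settled from step (d + 1) (N + 1) on; a step number depending on the
    coefficient alone keeps every coefficient polynomial in y.\<close>
  define u' where "u' y = (\<lambda>j \<alpha>. X (Suc (deg \<alpha>) * Suc N) y j \<alpha>)" for y
  have u'_X: "u' y - X k y \<in> vanishing M" if y: "y \<in> vanishing L" and k: "M * Suc N \<le> k" for y M k
    unfolding vanishing_iff
  proof (intro allI impI)
    fix j and \<alpha> :: "'n \<Rightarrow> nat" assume "deg \<alpha> < M"
    then have "Suc (deg \<alpha>) * Suc N \<le> k"
      using k by (meson Suc_leI le_trans mult_le_mono1)
    then obtain i where i: "k = Suc (deg \<alpha>) * Suc N + i" by (metis le_add_diff_inverse)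
    show "(u' y - X k y) j \<alpha> = 0"
      using X_stable[OF y, of "Suc (deg \<alpha>)" i] unfolding vanishing_iff i u'_def by simp
  qed
  show ?thesis
  proof (rule that)
    show "textile u'"
      using textile_X unfolding textile_iff_polyfun u'_def by simp
    show "u' 0 = 0" by (simp add: u'_def X_zero fun_eq_iff)
    show u'_in: "u' y \<in> vanishing L" if y: "y \<in> vanishing L" for y
      using vanishing_add[OF u'_X[OF y order_refl, of L] X_in[OF y, of "L * Suc N"]] by (simp only: diff_add_cancel)
    show u'_right: "u' y + g (u' y) = y" if y: "y \<in> vanishing L" for y
    proof -
      \<comment> \<open>Compare with two successive iterates, which satisfy
        \<open>X (Suc k) y + g (X k y) = y\<close> exactly.\<close>
      have "u' y + g (u' y) - y \<in> vanishing M" for M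
      proof -
        let ?k = "M * Suc N"
        have "g (u' y) - g (X ?k y) \<in> vanishing M"
          by (intro g_diff u'_X u'_in X_in y) simp
        moreover have "u' y - X (Suc ?k) y \<in> vanishing M" by (rule u'_X[OF y]) simp
        ultimately have "g (u' y) - g (X ?k y) + (u' y - X (Suc ?k) y) \<in> vanishing M"
          by (rule vanishing_add)
        also have "g (u' y) - g (X ?k y) + (u' y - X (Suc ?k) y) = u' y + g (u' y) - y"
          unfolding X_Suc by (intro ext) simp
        finally show ?thesis .
      qed
      then have "u' y + g (u' y) - y = 0" by (rule eq_zero_if_vanishing)
      then show ?thesis by (simp only: right_minus_eq)
    qed
    \<comment> \<open>The difference of two preimages is reproduced, up to sign, by the difference
      of their values under \<open>g\<close>, so contractivity raises its depth without
      bound.\<close>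
    have inj: "a = b" if ab: "a \<in> vanishing L" "b \<in> vanishing L" "a + g a = b + g b" for a b
    proof -
      have eq: "g a - g b = b - a" "g b - g a = a - b" 
        by (rule diff_eq_diff_if_add_eq, simp only: ab(3))+
      have depth: "ORD_ge \<nn> N k (a - b) \<and> ORD_ge \<nn> N k (b - a)" for k
      proof (induction k)
        case (Suc k)
        have "a \<in> U" "b \<in> U" using ab(1,2) L by blast+
        then have "ORD_ge \<nn> N (Suc k) (g b - g a) \<and> ORD_ge \<nn> N (Suc k) (g a - g b)"
          by (intro conjI contractive_ORD_ge[OF nil contr] conjunct1[OF Suc] conjunct2[OF Suc])
        then show ?case unfolding eq .
      qed (simp add: ORD_ge_0)
      have "a - b \<in> vanishing M" for M
        by (rule vanishing_if_ORD_ge[OF nil conjunct1[OF depth]])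
      then have "a - b = 0" by (rule eq_zero_if_vanishing)
      then show ?thesis by (simp only: right_minus_eq)
    qed
    have u_in: "c + g c \<in> vanishing L" if "c \<in> vanishing L" for c
      by (rule vanishing_add[OF that g_in[OF that]])
    show "u' (c + g c) = c" if c: "c \<in> vanishing L" for c
      by (rule inj[OF u'_in[OF u_in[OF c]] c u'_right[OF u_in[OF c]]])
    show "bij_betw (\<lambda>c. c + g c) (vanishing L) (vanishing L)"
      unfolding bij_betw_def
    proof
      show "inj_on (\<lambda>c. c + g c) (vanishing L)" using inj by (auto intro: inj_onI)
      show "(\<lambda>c. c + g c) ` vanishing L = vanishing L"
      proof
        show "vanishing L \<subseteq> (\<lambda>c. c + g c) ` vanishing L"
        proof
          fix y :: "('m, 'n, 'a) cords" assume y: "y \<in> vanishing L"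
          show "y \<in> (\<lambda>c. c + g c) ` vanishing L"
            by (rule image_eqI[OF _ u'_in[OF y]]) (simp add: u'_right[OF y])
        qed
      qed (use u_in in blast)
    qed
  qed
qed


section \<open>The rank condition along a universal curve\<close>

text \<open>Curves are textile in infinitely many coefficients, so one curve can run through all pairs
  of vectors near zero: distribute the coefficients of a single cord among the pair.\<close>

lemma universal_curve:
  obtains x w :: "(unit, 'n::finite, 'a::comm_ring_1) cords \<Rightarrow> ('m::finite, 'n, 'a) cords"
  where "textile x" "textile w" "x 0 = 0" "w 0 = 0"
    "\<forall>V. nhd0 V \<longrightarrow> (\<exists>L. \<forall>a\<in>vanishing L. \<forall>b\<in>vanishing L. \<exists>s\<in>V. x s = a \<and> w s = b)"
proof -
  \<comment> \<open>The slots are the constant multi-indices numbered by \<open>to_nat\<close>; they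
    are available in any number of variables.\<close>
  define \<iota> :: "bool \<times> 'm \<times> ('n \<Rightarrow> nat) \<Rightarrow> 'n \<Rightarrow> nat" where "\<iota> t = (\<lambda>_. to_nat t)" for t
  have inj: "inj \<iota>"
    by (rule injI) (metis \<iota>_def inj_eq inj_to_nat)
  define x where "x s = (\<lambda>j \<alpha>. s () (\<iota> (False, j, \<alpha>)))" for s :: "(unit, 'n, 'a) cords"
  define w where "w s = (\<lambda>j \<alpha>. s () (\<iota> (True, j, \<alpha>)))" for s :: "(unit, 'n, 'a) cords"
  show ?thesis
  proof (rule that[of x w])
    show "textile x" "textile w"
      by (simp_all add: textile_iff_polyfun x_def w_def polyfun.coord)
    show "x 0 = 0" "w 0 = 0" by (simp_all add: x_def w_def fun_eq_iff)
    show "\<forall>V. nhd0 V \<longrightarrow> (\<exists>L. \<forall>a\<in>vanishing L. \<forall>b\<in>vanishing L. \<exists>s\<in>V. x s = a \<and> w s = b)"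
    proof (intro allI impI)
      fix V :: "(unit, 'n, 'a) cords set" assume "nhd0 V"
      then obtain K where K: "vanishing K \<subseteq> V" unfolding nhd0_iff by blast
      \<comment> \<open>Only finitely many slots have degree below \<open>K\<close>, so pairs
        vanishing to a high enough order leave all of these empty.\<close>
      have "finite (\<iota> -` {\<beta>. deg \<beta> < K})"
        by (rule finite_vimageI[OF finite_deg_less inj])
      then have "finite ((\<lambda>(b, j, \<alpha>). deg \<alpha>) ` (\<iota> -` {\<beta>. deg \<beta> < K}))" by (rule finite_imageI)
      then obtain L where "\<forall>d\<in>(\<lambda>(b, j, \<alpha>). deg \<alpha>) ` (\<iota> -` {\<beta>. deg \<beta> < K}). d < L"
        unfolding finite_nat_set_iff_bounded by blast
      then have L: "deg \<alpha> < L" if "deg (\<iota> (b, j, \<alpha>)) < K" for b j \<alpha> using that by force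
      show "\<exists>L. \<forall>a\<in>vanishing L. \<forall>b\<in>vanishing L. \<exists>s\<in>V. x s = a \<and> w s = b"
      proof (intro exI ballI)
        fix a b :: "('m, 'n, 'a) cords" assume ab: "a \<in> vanishing L" "b \<in> vanishing L"
        define e where "e t = (case t of (t0, j, \<alpha>) \<Rightarrow> (if t0 then b else a) j \<alpha>)" for t
        define s where "s = (\<lambda>i::unit. \<lambda>\<beta>. if \<beta> \<in> range \<iota> then e (inv \<iota> \<beta>) else 0)"
        have s: "s () (\<iota> t) = e t" for t by (simp add: s_def inv_f_f[OF inj])
        have "s i \<beta> = 0" if "deg \<beta> < K" for i \<beta>
        proof (cases "\<beta> \<in> range \<iota>")
          case True
          then obtain t0 j \<alpha> where \<beta>: "\<beta> = \<iota> (t0, j, \<alpha>)" by auto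
          then have "deg \<alpha> < L" using L that by blast
          then show ?thesis using s[of "(t0, j, \<alpha>)"] ab \<beta> by (simp add: e_def vanishing_iff)
        qed (simp add: s_def)
        then have "s \<in> V" using K by (auto simp: vanishing_iff)
        moreover have "x s = a" "w s = b" by (simp_all add: x_def w_def s e_def)
        ultimately show "\<exists>s\<in>V. x s = a \<and> w s = b" by blast
      qed
    qed
  qed
qed

lemma curve_if_textile: "textile \<gamma> \<Longrightarrow> nhd0 V \<Longrightarrow> \<gamma> ` V \<subseteq> M \<Longrightarrow> curve M \<gamma>"
  unfolding curve_def textile_on_def by blast

text \<open>The curve \<open>\<eta>\<close> of tangent vectors of \<open>f u'\<close> in kernel
  directions decomposes in two ways: with second part 0 by the chain rule, and with first part 0
  because it runs in the complement. Uniqueness makes it vanish near 0, and the universal curve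
  turns this into a uniform statement about points and directions.\<close>

lemma constant_rank_tangent_eq_0:
  fixes f l :: "('m::finite, 'n::finite, 'a::comm_ring_1) cords \<Rightarrow> ('p::finite, 'n, 'a) cords"
  assumes torsion_free: "\<forall>n (x::'a). of_nat (Suc n) * x = 0 \<longrightarrow> x = 0"
    and f: "textile f" and u': "textile u'" "u' 0 = 0" and scission: "scission l \<sigma>"
    and B: "\<And>x. x \<in> vanishing L \<Longrightarrow> u' x \<in> U" "\<And>x. x \<in> vanishing L \<Longrightarrow> l (\<sigma> (f (u' x))) = l x"
    and rank: "constant_rank f U {y. l (\<sigma> y) = 0}"
  shows "\<exists>K. \<forall>x\<in>vanishing K. \<forall>w\<in>vanishing K. l w = 0 \<longrightarrow> tangent (\<lambda>c. f (u' c)) x w = 0"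
proof -
  interpret l: module_hom smult_cords smult_cords l
    using scission by (auto simp: scission_def textile_linear_def)
  interpret \<sigma>: module_hom smult_cords smult_cords \<sigma>
    using scission by (auto simp: scission_def textile_linear_def)
  have lsl: "l (\<sigma> (l x)) = l x" for x
    using scission unfolding scission_def by (metis comp_apply)
  have textile: "textile l" "textile \<sigma>"
    using scission by (auto simp: scission_def textile_linear_def)
  have hom: "module_hom smult_cords smult_cords (\<lambda>y. l (\<sigma> y))"
    using module_hom_compose[OF \<sigma>.module_hom_axioms l.module_hom_axioms] by (simp add: comp_def)
  let ?\<phi> = "\<lambda>c. f (u' c)" and ?J = "{y. l (\<sigma> y) = 0}"
  note textile_tangent = textile_tangent[OF torsion_free]
    and tangent_compose = tangent_compose[OF torsion_free]
    and tangent_linear = tangent_linear[OF torsion_free]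
  have textile_\<phi>: "textile ?\<phi>" by (rule textile_compose[OF f u'(1)])
  have in_J: "tangent ?\<phi> x w \<in> ?J" if "x \<in> vanishing L" "w \<in> vanishing L" "l w = 0" for x w
  proof -
    have "l (\<sigma> (tangent ?\<phi> x w)) = tangent (\<lambda>y. l (\<sigma> y)) (?\<phi> x) (tangent ?\<phi> x w)"
      by (simp add: tangent_linear[OF hom])
    also have "\<dots> = tangent (\<lambda>c. l (\<sigma> (?\<phi> c))) x w"
      by (rule tangent_compose[OF _ textile_\<phi>, symmetric]) (rule textile_compose[OF textile])
    \<comment> \<open>The identity being differentiated holds only on \<open>vanishing L\<close>,
      but the tangent sees just the line x + s w, which stays there.\<close>
    also have "\<dots> = tangent l x w"
      unfolding tangent_def
      using B(2)[OF vanishing_add[OF that(1) vanishing_smult[OF that(2)]]] B(2)[OF that(1)] by simp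
    also have "\<dots> = 0" by (simp add: tangent_linear[OF l.module_hom_axioms] that(3))
    finally show ?thesis by simp
  qed
  obtain x w0 :: "(unit, 'n, 'a) cords \<Rightarrow> ('m, 'n, 'a) cords"
    where x: "textile x" "x 0 = 0" and w0: "textile w0" "w0 0 = 0" and
      cover: "\<forall>V. nhd0 V \<longrightarrow> (\<exists>L. \<forall>a\<in>vanishing L. \<forall>b\<in>vanishing L. \<exists>s\<in>V. x s = a \<and> w0 s = b)"
    by (rule universal_curve)
  \<comment> \<open>Projection to the kernel of \<open>l\<close>; it fixes kernel vectors, so every
    small kernel direction is still reached.\<close>
  define w where "w s = w0 s - \<sigma> (l (w0 s))" for s
  have w: "textile w" "w 0 = 0"
    unfolding w_def[abs_def]
    by (rule textile_diff[OF w0(1) textile_compose[OF textile(2) textile_compose[OF textile(1) w0(1)]]])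
      (simp add: w0(2) l.zero \<sigma>.zero)
  have l_w: "l (w s) = 0" for s by (simp add: w_def l.diff lsl)
  define \<gamma> where "\<gamma> s = u' (x s)" for s
  define \<rho> where "\<rho> s = tangent u' (x s) (w s)" for s
  define \<eta> where "\<eta> s = tangent ?\<phi> (x s) (w s)" for s
  have \<eta>: "\<eta> s = tangent f (\<gamma> s) (\<rho> s)" for s
    unfolding \<eta>_def \<gamma>_def \<rho>_def by (rule tangent_compose[OF f u'(1)])
  have textile_curves: "textile \<gamma>" "textile \<rho>" "textile \<eta>"
    unfolding \<gamma>_def[abs_def] \<rho>_def[abs_def] \<eta>_def[abs_def]
    by (intro textile_compose[OF u'(1) x(1)] textile_tangent[OF u'(1) x(1) w(1)]
        textile_tangent[OF textile_\<phi> x(1) w(1)])+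
  define V where "V = x -` vanishing L \<inter> w -` vanishing L"
  have V: "nhd0 V"
    unfolding V_def by (intro nhd0_Int nhd0_textile_vimage x w nhd0_vanishing)
  have "curve U \<gamma>"
    by (rule curve_if_textile[OF textile_curves(1) V]) (auto simp: V_def \<gamma>_def B(1))
  moreover have "\<gamma> 0 = 0" by (simp add: \<gamma>_def x(2) u'(2))
  moreover have "curve UNIV \<eta>" by (rule curve_if_textile[OF textile_curves(3) V]) simp
  ultimately obtain \<rho>0 \<tau>0 where unique: "\<And>\<rho>' \<tau>'. rank_decomp f ?J \<gamma> \<eta> \<rho>' \<tau>' \<Longrightarrow>
      nhd0 {s. tangent f (\<gamma> s) (\<rho>' s) = tangent f (\<gamma> s) (\<rho>0 s) \<and> \<tau>' s = \<tau>0 s}"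
    using rank unfolding constant_rank_def by blast
  have "rank_decomp f ?J \<gamma> \<eta> \<rho> (\<lambda>s. 0)"
    unfolding rank_decomp_def
  proof (intro conjI)
    show "curve UNIV \<rho>" by (rule curve_if_textile[OF textile_curves(2) V]) simp
    show "curve ?J (\<lambda>s. 0)"
      by (rule curve_if_textile[OF textile_const V]) (auto simp: l.zero \<sigma>.zero)
    show "nhd0 {s. \<eta> s = tangent f (\<gamma> s) (\<rho> s) + 0}" by (simp add: \<eta> nhd0_UNIV)
  qed
  moreover have "rank_decomp f ?J \<gamma> \<eta> (\<lambda>s. 0) \<eta>"
    unfolding rank_decomp_def
  proof (intro conjI)
    show "curve UNIV (\<lambda>s::(unit, 'n, 'a) cords. 0 :: ('m, 'n, 'a) cords)"
      by (rule curve_if_textile[OF textile_const V]) simp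
    show "curve ?J \<eta>"
    proof (rule curve_if_textile[OF textile_curves(3) V], rule image_subsetI)
      show "\<eta> s \<in> ?J" if "s \<in> V" for s
        unfolding \<eta>_def by (rule in_J) (use that l_w in \<open>auto simp: V_def\<close>)
    qed
    show "nhd0 {s. \<eta> s = tangent f (\<gamma> s) 0 + \<eta> s}"
      by (simp add: tangent_zero_direction[OF torsion_free] nhd0_UNIV)
  qed
  \<comment> \<open>Comparing the complement parts of both decompositions with
    \<open>\<tau>0\<close> gives \<open>\<eta> s = 0\<close>.\<close>
  ultimately have "nhd0 ({s. tangent f (\<gamma> s) (\<rho> s) = tangent f (\<gamma> s) (\<rho>0 s) \<and> 0 = \<tau>0 s} \<inter>
      {s. tangent f (\<gamma> s) 0 = tangent f (\<gamma> s) (\<rho>0 s) \<and> \<eta> s = \<tau>0 s})"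
    by (intro nhd0_Int unique)
  then have "nhd0 {s. \<eta> s = 0}" by (rule nhd0_mono) auto
  from cover[rule_format, OF this] obtain K
    where K: "\<forall>a\<in>vanishing K. \<forall>b\<in>vanishing K. \<exists>s\<in>{s. \<eta> s = 0}. x s = a \<and> w0 s = b" ..
  show ?thesis
  proof (intro exI[of _ K] ballI impI)
    fix a b :: "('m, 'n, 'a) cords" assume ab: "a \<in> vanishing K" "b \<in> vanishing K" "l b = 0"
    from K[rule_format, OF ab(1,2)] obtain s where "\<eta> s = 0" "x s = a" "w0 s = b" by auto
    moreover from this have "w s = b" by (simp add: w_def ab(3) \<sigma>.zero)
    ultimately show "tangent ?\<phi> a b = 0" by (simp add: \<eta>_def)
  qed
qed


section \<open>Linearization\<close>

text \<open>Multiplication by n + 1 is the action of a nonzero scalar of \<open>'k\<close>.\<close>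

lemma k_algebra_torsion_free:
  fixes scl :: "'k::field_char_0 \<Rightarrow> 'a::comm_ring_1 \<Rightarrow> 'a"
  assumes "k_algebra scl" "of_nat (Suc n) * x = 0"
  shows "x = (0::'a)"
proof -
  interpret vector_space scl using assms(1) by (simp add: k_algebra_def)
  have "scl (of_nat m) 1 = of_nat m" for m
    by (induction m) (simp_all add: scale_left_distrib)
  moreover have "scl (of_nat (Suc n)) (1 * x) = scl (of_nat (Suc n)) 1 * x"
    using assms(1) unfolding k_algebra_def by blast
  ultimately have "scl (of_nat (Suc n)) x = 0" using assms(2) by (metis mult_1)
  then show ?thesis unfolding scale_eq_0_iff of_nat_eq_0_iff by simp
qed

theorem theorem4p6:
  fixes scl :: "'k::field_char_0 \<Rightarrow> 'a::comm_ring_1 \<Rightarrow> 'a"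
    and \<nn> :: "'a set" and N :: nat
    and U :: "('m::finite, 'n::finite, 'a) cords set"
    and f l h :: "('m, 'n, 'a) cords \<Rightarrow> ('p::finite, 'n, 'a) cords"
    and \<sigma> :: "('p, 'n, 'a) cords \<Rightarrow> ('m, 'n, 'a) cords"
  assumes "test_ring scl \<nn>" and "ideal_pow \<nn> N = {0}"
    and "nhd0 U" and "textile f" and "f 0 = 0"
    and "l = tangent f 0" and "h = f - l"
    and "scission l \<sigma>"
    and "contractive \<nn> N U (\<sigma> \<circ> h)"
    and "constant_rank f U {y. l (\<sigma> y) = 0}"
  shows "\<exists>u u' v. local_inverse_on U u u' \<and> locally_invertible_on (f ` U) v \<and>
           nhd0 {x. u' x \<in> U \<and> v (f (u' x)) = l x}"
proof -
  have torsion_free: "\<forall>n (x::'a). of_nat (Suc n) * x = 0 \<longrightarrow> x = 0"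
    using assms(1) k_algebra_torsion_free unfolding test_ring_def by blast
  interpret l: module_hom smult_cords smult_cords l
    using assms(8) by (auto simp: scission_def textile_linear_def)
  interpret \<sigma>: module_hom smult_cords smult_cords \<sigma>
    using assms(8) by (auto simp: scission_def textile_linear_def)
  have lsl: "l (\<sigma> (l x)) = l x" for x
    using assms(8) unfolding scission_def by (metis comp_apply)
  have textile: "textile l" "textile \<sigma>"
    using assms(8) by (auto simp: scission_def textile_linear_def)
  have h: "h c = f c - l c" for c using assms(7) by simp
  define g where "g c = \<sigma> (h c)" for c
  have textile_g: "textile g"
    unfolding g_def[abs_def] h
    by (rule textile_compose[OF textile(2) textile_diff[OF assms(4) textile(1)]])
  have g_0: "g 0 = 0" by (simp add: g_def h assms(5) l.zero \<sigma>.zero)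
  have "\<sigma> \<circ> h = g" by (simp add: g_def fun_eq_iff)
  then have contr: "contractive \<nn> N U g" using assms(9) by simp
  obtain L where L: "vanishing L \<subseteq> U" using assms(3) unfolding nhd0_iff by blast
  define u where "u c = c + g c" for c
  have textile_u: "textile u"
    unfolding u_def[abs_def] by (intro textile_add textile_ident textile_g)
  obtain u' where u': "textile u'" "u' 0 = 0" "bij_betw u (vanishing L) (vanishing L)"
    and u'_in: "\<And>c. c \<in> vanishing L \<Longrightarrow> u' c \<in> vanishing L"
    and u'_left: "\<And>c. c \<in> vanishing L \<Longrightarrow> u' (u c) = c"
    and u'_right: "\<And>c. c \<in> vanishing L \<Longrightarrow> u (u' c) = c"
    by (rule contractive_perturbation_inverse[OF assms(2) textile_g g_0 contr L, folded u_def]) blast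
  \<comment> \<open>With \<open>h = f - l\<close> and l \<sigma> l = l the linear terms cancel in l
    (c + \<sigma> (h c)).\<close>
  have l_u: "l (\<sigma> (f c)) = l (u c)" for c
    by (simp add: u_def g_def h l.add l.diff \<sigma>.diff lsl)
  define \<phi> where "\<phi> c = f (u' c)" for c
  have textile_\<phi>: "textile \<phi>" unfolding \<phi>_def[abs_def] by (rule textile_compose[OF assms(4) u'(1)])
  have \<phi>_0: "\<phi> 0 = 0" by (simp add: \<phi>_def u'(2) assms(5))
  have l_\<phi>: "l (\<sigma> (\<phi> c)) = l c" if "c \<in> vanishing L" for c
    unfolding \<phi>_def l_u u'_right[OF that] ..
  have "\<exists>K. \<forall>x\<in>vanishing K. \<forall>w\<in>vanishing K. l w = 0 \<longrightarrow> tangent \<phi> x w = 0"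
    unfolding \<phi>_def[abs_def]
  proof (rule constant_rank_tangent_eq_0[OF torsion_free assms(4) u'(1,2) assms(8) _ _ assms(10)])
    show "u' x \<in> U" if "x \<in> vanishing L" for x using that u'_in L by blast
    show "l (\<sigma> (f (u' x))) = l x" if "x \<in> vanishing L" for x using that l_\<phi> by (simp add: \<phi>_def)
  qed
  then obtain K where K: "\<And>x w. x \<in> vanishing K \<Longrightarrow> w \<in> vanishing K \<Longrightarrow> l w = 0 \<Longrightarrow> tangent \<phi> x w = 0"
    by blast
  \<comment> \<open>\<open>vanishing K\<close> is closed under sums and scalars, so it contains the
    whole line through x in direction w.\<close>
  have \<phi>_invariant: "\<phi> (x + w) = \<phi> x" if "x \<in> vanishing K" "w \<in> vanishing K" "l w = 0" for x w
    by (rule constant_along_line[OF torsion_free textile_\<phi>])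
      (intro K vanishing_add vanishing_smult that)

  \<comment> \<open>The component in the kernel of l \<sigma> of \<phi> at a point that depends on l
    (\<sigma> y) alone. For small x one has \<phi> x = l x + r (\<phi> x), a graph over the image of
    \<open>l\<close>, which \<open>v\<close> straightens.\<close>
  define r where "r y = \<phi> (\<sigma> (l (\<sigma> y))) - l (\<sigma> (\<phi> (\<sigma> (l (\<sigma> y)))))" for y
  have textile_r: "textile r"
    unfolding r_def[abs_def]
    by (intro textile_diff textile_compose[OF textile_\<phi>] textile_compose[OF textile(1)]
        textile_compose[OF textile(2)] textile(2))
  have l_r: "l (\<sigma> (r y)) = 0" for y by (simp add: r_def \<sigma>.diff l.diff lsl)
  have r_cong: "r y = r z" if "l (\<sigma> y) = l (\<sigma> z)" for y z using that by (simp add: r_def)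
  define v where "v y = y - r y" for y
  define v' where "v' y = y + r y" for y
  \<comment> \<open>Values of \<open>r\<close> lie in the kernel of l \<sigma>, so adding or
    subtracting them leaves l (\<sigma> y), and hence \<open>r\<close>, unchanged: \<open>v\<close>
    is a shear with inverse \<open>v'\<close>.\<close>
  have r_v: "r (v y) = r y" and r_v': "r (v' y) = r y" for y
    by (rule r_cong, simp add: v_def v'_def \<sigma>.diff \<sigma>.add l.diff l.add l_r)+
  have v'_v: "v' (v y) = y" and v_v': "v (v' y) = y" for y
    using r_v[of y] r_v'[of y] by (simp_all add: v'_def[of "v y"] v_def[of "v' y"]) (simp_all add: v_def v'_def)
  have "local_inverse_on U u u'"
    unfolding local_inverse_on_def
    by (intro exI[of _ u] exI[of _ "vanishing L"] conjI)
      (use textile_u u' u'_left g_0 nhd0_vanishing in \<open>auto simp: u_def[of 0] textile_on_def\<close>)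
  moreover have "local_inverse_on (f ` U) v v'"
    unfolding local_inverse_on_def
  proof (intro exI[of _ v] exI[of _ UNIV] conjI)
    show "textile v" unfolding v_def[abs_def] by (intro textile_diff textile_ident textile_r)
    show "v 0 = 0" by (simp add: v_def r_def \<sigma>.zero l.zero \<phi>_0)
    show "bij_betw v UNIV UNIV" using v'_v v_v' by (intro bij_betw_byWitness[of _ v']) auto
    have "textile v'" unfolding v'_def[abs_def] by (intro textile_add textile_ident textile_r)
    then show "textile_on UNIV v'" unfolding textile_on_def by blast
  qed (simp_all add: v'_v nhd0_UNIV)
  moreover have "nhd0 {x. u' x \<in> U \<and> v (f (u' x)) = l x}"
  proof (rule nhd0_mono)
    let ?W = "vanishing K \<inter> vanishing L"
    \<comment> \<open>Both x and its representative \<sigma> (l x) must be small: their difference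
      is the kernel direction along which \<phi> is constant.\<close>
    show "nhd0 (?W \<inter> (\<lambda>x. \<sigma> (l x)) -` ?W)"
      by (intro nhd0_Int nhd0_vanishing nhd0_textile_vimage textile_compose[OF textile(2,1)])
        (simp add: l.zero \<sigma>.zero)
    show "?W \<inter> (\<lambda>x. \<sigma> (l x)) -` ?W \<subseteq> {x. u' x \<in> U \<and> v (f (u' x)) = l x}"
    proof
      fix x assume x: "x \<in> ?W \<inter> (\<lambda>x. \<sigma> (l x)) -` ?W"
      have "\<phi> (x + (\<sigma> (l x) - x)) = \<phi> x"
        by (rule \<phi>_invariant) (use x in \<open>auto simp: vanishing_diff l.diff lsl\<close>)
      then have "\<phi> (\<sigma> (l x)) = \<phi> x" by simp
      then have "r (\<phi> x) = \<phi> x - l x" using x by (simp add: r_def l_\<phi> lsl)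
      then have "v (f (u' x)) = l x" by (simp add: v_def \<phi>_def)
      then show "x \<in> {x. u' x \<in> U \<and> v (f (u' x)) = l x}" using x u'_in L by blast
    qed
  qed
  ultimately show ?thesis unfolding locally_invertible_on_def by blast
qed

end
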